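(* Let $k$ be a non-negative integer and $m$ a positive integer. For $|q|<1$, and for either choice of sign (upper signs throughout, or lower signs throughout), \begin{enumerate} \item[(i)] $\displaystyle \sum_{j=k}^\infty (\mp 1)^{j-k} \binom{2j}{j-k} V^{\pm}_{j,m}(q) = (\pm q;q)^2_m\,q^k\, H_{k,m}(q,q^2)$; \item[(ii)] $\displaystyle \sum_{j=k}^\infty (\mp 1)^{j-k} \binom{2j}{j-k} W^{\pm}_{j,m}(q)=(\pm q;q^2)^2_m\,q^k\,H_{k,m}(q^2,q^2)$. \end{enumerate}
   Context: For $n\ge 0$, $(a;q)_n=\prod_{r=0}^{n-1}(1-aq^r)$ with $(a;q)_0=1$. For integers $m,k$ and a base $p$, the Gaussian polynomial is ${m \brack k}_p=\frac{(p;p)_m}{(p;p)_k(p;p)_{m-k}}$ if $0\le k\le m$ and $0$ otherwise. For non-negative integers $k,m$ define $$V^{\pm}_{k,m}(q)=\sum_{1\le n_1\le n_2\le\cdots\le n_k\le m}\prod_{i=1}^k\frac{q^{n_i}}{(1\mp q^{n_i})^2},\qquad W^{\pm}_{k,m}(q)=\sum_{1\le n_1\le\cdots\le n_k\le m}\prod_{i=1}^k\frac{q^{2n_i-1}}{(1\mp q^{2n_i-1})^2},$$ with $V^{\pm}_{0,m}(q)=W^{\pm}_{0,m}(q)=1$. Define $$H_{k,m}(p,z)=\sum_{j=0}^\infty {m-1+j \brack j}_p {m-1+k+j \brack k+j}_p z^{j},$$ so that $H_{k,m}(q,q^2)$ uses base $q$ and $z=q^2$, and $H_{k,m}(q^2,q^2)$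 uses base $q^2$ and $z=q^2$.
   Formalization: The left-hand series can diverge for |q|<1 (k=0, m=1, upper signs, q=1/2), so the identities are proved as formal power series in q, and for each complex |q|<1 at which the left series converges, which is shown if all |q^n/(1∓q^n)^2| (resp. with 2n−1 for n) are < 1/4. *)

theory Defs
  imports "HOL-Analysis.Analysis" "HOL-Computational_Algebra.Formal_Power_Series"
begin

text \<open>
  All notions are polymorphic, so that they can be used both at a complex number \<open>q\<close> and at the
  indeterminate \<open>q = fps_X\<close> of a formal power series ring (with its \<open>X\<close>-adic topology). In the
  latter case all denominators below have constant term 1, so division is genuine division.

  A sign \<open>s \<in> {1, -1}\<close> encodes the choice of signs: \<open>s = 1\<close> for the upper signs, \<open>s = -1\<close> for the
  lower signs; so \<open>\<plusminus>\<close> is \<open>s\<close> and \<open>\<mp>\<close> is \<open>-s\<close>.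
\<close>

definition qpoch :: "'a::comm_ring_1 \<Rightarrow> 'a \<Rightarrow> nat \<Rightarrow> 'a" where
  "qpoch a q n = (\<Prod>r<n. 1 - a * q ^ r)"

definition gauss_binom :: "'a::{comm_ring_1,inverse} \<Rightarrow> int \<Rightarrow> int \<Rightarrow> 'a" where
  "gauss_binom p m k =
     (if 0 \<le> k \<and> k \<le> m
      then qpoch p p (nat m) / (qpoch p p (nat k) * qpoch p p (nat (m - k)))
      else 0)"

definition chains :: "nat \<Rightarrow> nat \<Rightarrow> nat list set" where
  "chains k m = {ns. length ns = k \<and> sorted ns \<and> set ns \<subseteq> {1..m}}"

definition V :: "int \<Rightarrow> nat \<Rightarrow> nat \<Rightarrow> 'a::{comm_ring_1,inverse} \<Rightarrow> 'a" where
  "V s k m q =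
     (\<Sum>ns\<in>chains k m. \<Prod>i<k. q ^ (ns ! i) / (1 - of_int s * q ^ (ns ! i))\<^sup>2)"

definition W :: "int \<Rightarrow> nat \<Rightarrow> nat \<Rightarrow> 'a::{comm_ring_1,inverse} \<Rightarrow> 'a" where
  "W s k m q =
     (\<Sum>ns\<in>chains k m.
        \<Prod>i<k. q ^ (2 * (ns ! i) - 1) / (1 - of_int s * q ^ (2 * (ns ! i) - 1))\<^sup>2)"

definition H :: "nat \<Rightarrow> nat \<Rightarrow> 'a::{comm_ring_1,inverse,topological_space} \<Rightarrow> 'a \<Rightarrow> 'a" where
  "H k m p z =
     (\<Sum>j. gauss_binom p (int m - 1 + int j) (int j)
          * gauss_binom p (int m - 1 + int k + int j) (int k + int j) * z ^ j)"

text \<open>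
  The terms of the two series over \<open>j \<ge> k\<close>, indexed by \<open>i = j - k\<close>.
\<close>

definition V_term :: "int \<Rightarrow> nat \<Rightarrow> nat \<Rightarrow> 'a::{comm_ring_1,inverse} \<Rightarrow> nat \<Rightarrow> 'a" where
  "V_term s k m q i =
     (- of_int s) ^ i * of_nat ((2 * (k + i)) choose i) * V s (k + i) m q"

definition W_term :: "int \<Rightarrow> nat \<Rightarrow> nat \<Rightarrow> 'a::{comm_ring_1,inverse} \<Rightarrow> nat \<Rightarrow> 'a" where
  "W_term s k m q i =
     (- of_int s) ^ i * of_nat ((2 * (k + i)) choose i) * W s (k + i) m q"

end

theory Submission
  imports Defs
begin

text \<open>
  Write \<open>a n = y n / (1 - s y n)\<^sup>2\<close> with \<open>y n = q\<^sup>n\<close> (for \<open>V\<close>) or \<open>y n = q\<^bsup>2n-1\<^esup>\<close> (for \<open>W\<close>). Then \<open>V\<close> and \<open>W\<close>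
  are complete homogeneous symmetric polynomials \<open>h\<^sub>j(a)\<close>, the left-hand side is
  \<open>A\<^sub>k = \<Sum>\<^sub>j [t\<^sup>k] (t - 2s + 1/t)\<^sup>j h\<^sub>j(a)\<close>, and by the \<open>q\<close>-binomial theorem the right-hand side is
  \<open>B\<^sub>k = \<Prod>\<^sub>n (1 - s y n)\<^sup>2 \<cdot> \<Sum>\<^sub>j h\<^sub>j(y) h\<^bsub>j+k\<^esub>(y)\<close>; formally both are the coefficient of \<open>t\<^sup>k\<close> in
  \<open>\<Prod>\<^sub>n (1 - s y n)\<^sup>2 / ((1 - y n t)(1 - y n / t))\<close>. Instead of manipulating Laurent series, add the
  parameters one at a time: adding \<open>y\<close>, both \<open>A\<close> and \<open>B\<close> satisfy
  \<open>(1 + y\<^sup>2) X\<^sub>k - y (X\<^bsub>k-1\<^esub> + X\<^bsub>k+1\<^esub>) = (1 - s y)\<^sup>2 X'\<^sub>k\<close>, where \<open>X'\<close> belongs to the smaller parameter set, and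
  the homogeneous recurrence has no nonzero solution with \<open>y\<^sup>N X\<^sub>N \<rightarrow> 0\<close>. This works verbatim for formal
  power series and for complex numbers with \<open>\<bar>a n\<bar> < 1/4\<close>. A convergent complex series forces
  \<open>\<bar>a n\<bar> \<le> 1/4\<close>, and Abel's limit theorem covers the boundary.
\<close>

subsection \<open>Complete homogeneous symmetric polynomials\<close>

text \<open>Split by whether a monomial contains the last variable, so that adding one parameter,
  the step of the later inductions on \<open>m\<close>, is a defining equation.\<close>

fun hsym :: "(nat \<Rightarrow> 'a::comm_semiring_1) \<Rightarrow> nat \<Rightarrow> nat \<Rightarrow> 'a" where
  "hsym x m 0 = 1"
| "hsym x 0 (Suc j) = 0"
| "hsym x (Suc m) (Suc j) = hsym x m (Suc j) + x (Suc m) * hsym x (Suc m) j"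

lemma hsym_0_left: "hsym x 0 j = (if j = 0 then 1 else 0)"
  by (cases j) auto

lemma hsym_cong:
  "(\<And>n. n \<in> {1..m} \<Longrightarrow> x n = y n) \<Longrightarrow> hsym x m j = hsym y m j"
  by (induction x m j rule: hsym.induct) auto

lemma hsym_scale: "hsym (\<lambda>n. c * x n) m j = c ^ j * hsym x m j"
  by (induction x m j rule: hsym.induct) (simp_all add: algebra_simps)

section \<open>Weakly increasing lists as monomials\<close>

lemma chains_0: "chains 0 m = {[]}"
  by (auto simp: chains_def)

lemma chains_Suc_0: "chains (Suc k) 0 = {}"
  by (auto simp: chains_def)

lemma finite_chains: "finite (chains k m)"
proof -
  have "chains k m \<subseteq> {ns. set ns \<subseteq> {1..m} \<and> length ns = k}"
    by (auto simp: chains_def)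
  then show ?thesis
    by (rule finite_subset) (rule finite_lists_length_eq, simp)
qed

text \<open>The last entry of a sorted list is its maximum: either it is \<open>Suc m\<close>, or
  the whole list stays within \<open>{1..m}\<close>. This mirrors the recursion of
  \<open>hsym\<close>.\<close>

lemma chains_Suc_Suc:
  "chains (Suc k) (Suc m) = chains (Suc k) m \<union> (\<lambda>ns. ns @ [Suc m]) ` chains k (Suc m)"
    (is "?L = ?R")
proof
  show "?R \<subseteq> ?L"
    by (fastforce simp: chains_def sorted_append)
  show "?L \<subseteq> ?R"
  proof
    fix ns assume ns: "ns \<in> ?L"
    then obtain ls l where eq: "ns = ls @ [l]"
      by (cases ns rule: rev_cases) (auto simp: chains_def)
    show "ns \<in> ?R"
    proof (cases "l = Suc m")
      case True
      with ns eq show ?thesis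
        by (auto simp: chains_def sorted_append)
    next
      case False
      with ns eq have "l \<le> m" "\<forall>n\<in>set ls. n \<le> l"
        by (auto simp: chains_def sorted_append)
      with ns eq show ?thesis
        by (fastforce simp: chains_def)
    qed
  qed
qed

lemma sum_chains_eq_hsym:
  "(\<Sum>ns\<in>chains k m. \<Prod>i<k. f (ns ! i)) = hsym f m k"
proof (induction f m k rule: hsym.induct)
  case (1 f m)
  then show ?case by (simp add: chains_0)
next
  case (2 f k)
  then show ?case by (simp add: chains_Suc_0)
next
  case (3 f m k)
  have disj: "chains (Suc k) m \<inter> (\<lambda>ns. ns @ [Suc m]) ` chains k (Suc m) = {}"
    by (auto simp: chains_def)
  have inj: "inj_on (\<lambda>ns. ns @ [Suc m]) (chains k (Suc m))"
    by (auto simp: inj_on_def)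
  have "(\<Sum>ns\<in>(\<lambda>ns. ns @ [Suc m]) ` chains k (Suc m). \<Prod>i<Suc k. f (ns ! i))
      = (\<Sum>ns\<in>chains k (Suc m). (\<Prod>i<k. f (ns ! i)) * f (Suc m))"
    unfolding sum.reindex[OF inj] o_def
    by (intro sum.cong) (auto simp: chains_def nth_append intro!: prod.cong)
  also have "\<dots> = f (Suc m) * hsym f (Suc m) k"
    unfolding sum_distrib_right[symmetric] 3(2) by (rule mult.commute)
  finally show ?case
    using 3(1) unfolding chains_Suc_Suc
    by (subst sum.union_disjoint) (auto simp: finite_chains disj simp del: prod.lessThan_Suc)
qed

text \<open>A \<open>p\<close>-Pascal rule drives a nested induction, outer on \<open>m\<close> and
  inner on \<open>j\<close>. Keeping the \<open>p\<close>-factorials on the left makes the identity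
  valid in any commutative ring.\<close>

lemma hsym_power:
  fixes p :: "'a::comm_ring_1"
  shows "hsym (\<lambda>n. p ^ (n - 1)) (Suc m) j * (qpoch p p j * qpoch p p m) = qpoch p p (m + j)"
proof (induction m arbitrary: j)
  case 0
  have "hsym (\<lambda>n. p ^ (n - 1)) (Suc 0) j = 1" for j
    by (induction j) auto
  then show ?case by (simp add: qpoch_def)
next
  case (Suc m)
  note IH = Suc.IH
  show ?case
  proof (induction j)
    case 0
    show ?case by (simp add: qpoch_def)
  next
    case (Suc j)
    let ?h = "hsym (\<lambda>n. p ^ (n - 1))" and ?P = "qpoch p p"
    have P: "?P (Suc n) = ?P n * (1 - p ^ Suc n)" for n
      by (simp add: qpoch_def)
    \<comment> \<open>The recursion of \<open>hsym\<close>, with newest variable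
      \<open>p ^ Suc m\<close>, multiplied by the \<open>p\<close>-factorials: the first summand
      falls under the outer hypothesis, the second under the inner one.\<close>
    have "?h (Suc (Suc m)) (Suc j) * (?P (Suc j) * ?P (Suc m))
        = (1 - p ^ Suc m) * (?h (Suc m) (Suc j) * (?P (Suc j) * ?P m))
          + p ^ Suc m * (1 - p ^ Suc j) * (?h (Suc (Suc m)) j * (?P j * ?P (Suc m)))"
      by (simp add: P algebra_simps)
    also have "\<dots> = ?P (Suc m + j) * (1 - p ^ Suc m + p ^ Suc m * (1 - p ^ Suc j))"
      unfolding Suc.IH IH by (simp add: algebra_simps)
    also have "1 - p ^ Suc m + p ^ Suc m * (1 - p ^ Suc j) = 1 - p ^ Suc (Suc m + j)"
      by (simp add: algebra_simps power_add)
    also have "?P (Suc m + j) * \<dots> = ?P (Suc m + Suc j)"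
      using P[of "Suc m + j"] by simp
    finally show ?case .
  qed
qed

text \<open>Non-vanishing \<open>p\<close>-factorials allow \<open>hsym_power\<close> to be divided
  out; complex \<open>p\<close> of modulus below 1 and power series without constant term both
  qualify.\<close>

lemma gauss_binom_eq_hsym:
  fixes p :: "'a::{idom_divide,inverse}"
  assumes "m > 0" and "\<And>n. qpoch p p n \<noteq> 0"
  shows "gauss_binom p (int m - 1 + int j) (int j) = hsym (\<lambda>n. p ^ (n - 1)) m j"
proof -
  from assms(1) obtain m' where m: "m = Suc m'"
    by (cases m) auto
  have "qpoch p p j * qpoch p p m' \<noteq> 0"
    using assms(2) by simp
  moreover have "nat (int m' + int j) = m' + j"
    by (simp add: nat_add_distrib)
  ultimately show ?thesis
    unfolding m gauss_binom_def using hsym_power[of p m' j, symmetric] by simp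
qed

subsection \<open>The three-term recurrence\<close>

text \<open>For \<open>s\<^sup>2 = 1\<close> this is the coefficient of \<open>t\<^sup>k\<close> in \<open>(t - 2s + 1/t)\<^bsup>k+i\<^esup>\<close>.\<close>
definition cbin :: "'a::comm_ring_1 \<Rightarrow> nat \<Rightarrow> nat \<Rightarrow> 'a" where
  "cbin s k i = (- s) ^ i * of_nat ((2 * (k + i)) choose i)"

lemma cbin_0: "cbin s k 0 = 1"
  by (simp add: cbin_def)

lemma cbin_Suc_0: "cbin s (Suc k) (Suc 0) = cbin s k (Suc 0) - 2 * s"
  by (simp add: cbin_def algebra_simps)

text \<open>Multiplication by one more factor t - 2s + 1/t: its three terms pass on the coefficients
  of t^k, t^(k+1) and t^(k+2). In binomials this is Pascal's rule used twice.\<close>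

lemma cbin_Suc_Suc:
  assumes "s * s = 1"
  shows "cbin s (Suc k) (Suc (Suc i))
       = cbin s k (Suc (Suc i)) - 2 * s * cbin s (Suc k) (Suc i) + cbin s (Suc (Suc k)) i"
proof -
  have eq: "2 * (Suc k + Suc (Suc i)) = Suc (Suc (2 * (k + Suc (Suc i))))"
       "2 * (Suc k + Suc i) = 2 * (k + Suc (Suc i))"
       "2 * (Suc (Suc k) + i) = 2 * (k + Suc (Suc i))"
    by simp_all
  have ss: "s * (s * x) = x" for x
    by (simp add: assms flip: mult.assoc)
  show ?thesis
    unfolding cbin_def eq by (simp add: algebra_simps ss)
qed

lemma cbin_0_Suc_0: "cbin s 0 (Suc 0) = - 2 * s * cbin s 0 0"
  by (simp add: cbin_def)

text \<open>The coefficients of t and 1/t agree by the symmetry t <-> 1/t; merging them gives the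
  factor 2.\<close>

lemma cbin_0_Suc_Suc:
  assumes "s * s = 1"
  shows "cbin s 0 (Suc (Suc i)) = - 2 * s * cbin s 0 (Suc i) + 2 * cbin s (Suc 0) i"
proof -
  have eq: "2 * (0 + Suc (Suc i)) = Suc (Suc (2 * Suc i))"
       "2 * (0 + Suc i) = 2 * Suc i"
       "2 * (Suc 0 + i) = 2 * Suc i"
    by simp_all
  have sym: "(2 * Suc i) choose (Suc (Suc i)) = (2 * Suc i) choose i"
    by (subst binomial_symmetric) auto
  have ss: "s * (s * x) = x" for x
    by (simp add: assms flip: mult.assoc)
  show ?thesis
    unfolding cbin_def eq binomial_Suc_Suc sym by (simp add: algebra_simps ss del: binomial_Suc_Suc)
qed

lemma sums_cmult:
  fixes f :: "nat \<Rightarrow> 'a::{comm_ring_1,topological_semigroup_mult}"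
  assumes "f sums l"
  shows "(\<lambda>n. c * f n) sums (c * l)"
  using tendsto_mult_left[OF assms[unfolded sums_def], of c]
  by (simp add: sums_def sum_distrib_left)

lemma sums_case_nat:
  fixes f :: "nat \<Rightarrow> 'a::{t2_space,topological_comm_monoid_add}"
  assumes "f sums l"
  shows "(\<lambda>n. case n of 0 \<Rightarrow> 0 | Suc i \<Rightarrow> f i) sums l"
  using sums_Suc[of "\<lambda>n. case n of 0 \<Rightarrow> 0 | Suc i \<Rightarrow> f i" l] assms by simp

lemma cbin_series_recurrence:
  fixes A G :: "nat \<Rightarrow> 'a::{comm_ring_1,t2_space,topological_ab_group_add,topological_semigroup_mult}"
  assumes s: "s * s = 1"
    and A: "\<And>k. (\<lambda>i. cbin s k i * hsym a (Suc m) (k + i)) sums A k"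
    and G: "\<And>k. (\<lambda>i. cbin s k i * hsym a m (k + i)) sums G k"
  shows "A (Suc k) = G (Suc k) + a (Suc m) * (A k - 2 * s * A (Suc k) + A (Suc (Suc k)))"
    and "A 0 = G 0 + a (Suc m) * (2 * A 1 - 2 * s * A 0)"
proof -
  let ?h = "hsym a (Suc m)" and ?a = "a (Suc m)"
  let ?sh = "\<lambda>f n. case n of 0 \<Rightarrow> 0 | Suc i \<Rightarrow> f i"
  let ?f = "\<lambda>k i. cbin s k i * ?h (k + i)"
  \<comment> \<open>Shifting by one and two places aligns the series: at index \<open>i\<close> all
    three carry the same factor \<open>hsym a (Suc m) (k + i)\<close>, so the recurrence of
    \<open>cbin\<close> applies termwise.\<close>
  have "(\<lambda>i. cbin s (Suc k) i * hsym a m (Suc k + i)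
        + ?a * (?f k i + (- 2 * s) * ?sh (?f (Suc k)) i + ?sh (?sh (?f (Suc (Suc k)))) i))
      sums (G (Suc k) + ?a * (A k + (- 2 * s) * A (Suc k) + A (Suc (Suc k))))"
    by (intro sums_add sums_cmult sums_case_nat A G)
  also have "(\<lambda>i. cbin s (Suc k) i * hsym a m (Suc k + i)
        + ?a * (?f k i + (- 2 * s) * ?sh (?f (Suc k)) i + ?sh (?sh (?f (Suc (Suc k)))) i))
      = ?f (Suc k)"
    by (auto simp: fun_eq_iff cbin_0 cbin_Suc_0 cbin_Suc_Suc[OF s] algebra_simps split: nat.split)
  finally show "A (Suc k) = G (Suc k) + ?a * (A k - 2 * s * A (Suc k) + A (Suc (Suc k)))"
    by - (drule sums_unique2[OF A[of "Suc k"]], simp add: algebra_simps)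
next
  let ?h = "hsym a (Suc m)" and ?a = "a (Suc m)"
  let ?sh = "\<lambda>f n. case n of 0 \<Rightarrow> 0 | Suc i \<Rightarrow> f i"
  let ?f = "\<lambda>k i. cbin s k i * ?h (k + i)"
  have "(\<lambda>i. cbin s 0 i * hsym a m (0 + i)
        + ?a * ((- 2 * s) * ?sh (?f 0) i + 2 * ?sh (?sh (?f 1)) i))
      sums (G 0 + ?a * ((- 2 * s) * A 0 + 2 * A 1))"
    by (intro sums_add sums_cmult sums_case_nat A G)
  also have "(\<lambda>i. cbin s 0 i * hsym a m (0 + i)
        + ?a * ((- 2 * s) * ?sh (?f 0) i + 2 * ?sh (?sh (?f 1)) i)) = ?f 0"
    by (auto simp: fun_eq_iff cbin_0 cbin_0_Suc_0 cbin_0_Suc_Suc[OF s] algebra_simps split: nat.split)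
  finally show "A 0 = G 0 + ?a * (2 * A 1 - 2 * s * A 0)"
    by - (drule sums_unique2[OF A[of 0]], simp add: algebra_simps)
qed

text \<open>Removing a parameter multiplies the generating function by (1 - y t)(1 - y/t):
  substitute h_j - y h_(j-1) in both factors and expand into four correlations.\<close>

lemma hsym_correlation_recurrence:
  fixes C D :: "nat \<Rightarrow> 'a::{comm_ring_1,t2_space,topological_ab_group_add,topological_semigroup_mult}"
  assumes C: "\<And>k. (\<lambda>j. hsym y (Suc m) j * hsym y (Suc m) (j + k)) sums C k"
    and D: "\<And>k. (\<lambda>j. hsym y m j * hsym y m (j + k)) sums D k"
  shows "D (Suc k) = (1 + (y (Suc m))\<^sup>2) * C (Suc k) - y (Suc m) * (C k + C (Suc (Suc k)))"
    and "D 0 = (1 + (y (Suc m))\<^sup>2) * C 0 - 2 * y (Suc m) * C 1"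
proof -
  let ?h = "hsym y (Suc m)" and ?y = "y (Suc m)"
  let ?sh = "\<lambda>f n. case n of 0 \<Rightarrow> 0 | Suc i \<Rightarrow> f i"
  let ?f = "\<lambda>k j. ?h j * ?h (j + k)"
  have g: "hsym y m (Suc j) = ?h (Suc j) - ?y * ?h j" for j
    by simp
  have "(\<lambda>j. ?f (Suc k) j + (- ?y) * ?f k j + (- ?y) * ?sh (?f (Suc (Suc k))) j
           + ?y\<^sup>2 * ?sh (?f (Suc k)) j)
      sums (C (Suc k) + (- ?y) * C k + (- ?y) * C (Suc (Suc k)) + ?y\<^sup>2 * C (Suc k))"
    by (intro sums_add sums_cmult sums_case_nat C)
  also have "(\<lambda>j. ?f (Suc k) j + (- ?y) * ?f k j + (- ?y) * ?sh (?f (Suc (Suc k))) j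
           + ?y\<^sup>2 * ?sh (?f (Suc k)) j) = (\<lambda>j. hsym y m j * hsym y m (j + Suc k))"
    unfolding add_Suc_right g
    by (auto simp: fun_eq_iff g power2_eq_square algebra_simps simp del: hsym.simps(3) split: nat.split)
  finally show "D (Suc k) = (1 + ?y\<^sup>2) * C (Suc k) - ?y * (C k + C (Suc (Suc k)))"
    by - (drule sums_unique2[OF D[of "Suc k"]], simp add: algebra_simps)
next
  let ?h = "hsym y (Suc m)" and ?y = "y (Suc m)"
  let ?sh = "\<lambda>f n. case n of 0 \<Rightarrow> 0 | Suc i \<Rightarrow> f i"
  let ?f = "\<lambda>k j. ?h j * ?h (j + k)"
  have g: "hsym y m (Suc j) = ?h (Suc j) - ?y * ?h j" for j
    by simp
  have "(\<lambda>j. ?f 0 j + (- 2 * ?y) * ?sh (?f 1) j + ?y\<^sup>2 * ?sh (?f 0) j)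
      sums (C 0 + (- 2 * ?y) * C 1 + ?y\<^sup>2 * C 0)"
    by (intro sums_add sums_cmult sums_case_nat C)
  also have "(\<lambda>j. ?f 0 j + (- 2 * ?y) * ?sh (?f 1) j + ?y\<^sup>2 * ?sh (?f 0) j)
      = (\<lambda>j. hsym y m j * hsym y m (j + 0))"
    by (auto simp: fun_eq_iff g power2_eq_square algebra_simps simp del: hsym.simps(3) split: nat.split)
  finally show "D 0 = (1 + ?y\<^sup>2) * C 0 - 2 * ?y * C 1"
    by - (drule sums_unique2[OF D[of 0]], simp add: algebra_simps)
qed

text \<open>For nonzero \<open>y\<close> the characteristic roots are y and 1/y. Passing to
  \<open>E\<close> removes y, the limit condition excludes 1/y, and what remains, D_k = y^k D_0,
  meets the initial equation \<open>rec0\<close> only for D_0 = 0.\<close>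

lemma recurrence_unique:
  fixes D :: "nat \<Rightarrow> 'a::{idom,t2_space,topological_ab_group_add,topological_semigroup_mult}"
  assumes rec: "\<And>k. (1 + y\<^sup>2) * D (Suc k) = y * (D k + D (Suc (Suc k)))"
    and rec0: "(1 + y\<^sup>2) * D 0 = 2 * y * D 1"
    and lim: "\<And>k. (\<lambda>N. y ^ N * D (N + k)) \<longlonglongrightarrow> 0"
    and y: "y\<^sup>2 \<noteq> 1"
  shows "D k = 0"
proof -
  define E where "E k = D (Suc k) - y * D k" for k
  have E: "E k = y * E (Suc k)" for k
    using rec[of k] by (simp add: E_def algebra_simps power2_eq_square)
  have E_pow: "E k = y ^ N * E (N + k)" for k N
  proof (induction N)
    case (Suc N)
    then show ?case using E[of "N + k"] by (simp add: algebra_simps)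
  qed simp
  have "E k = 0" for k
  proof -
    have "(\<lambda>N. y ^ N * D (N + Suc k) + (- y) * (y ^ N * D (N + k))) \<longlonglongrightarrow> 0 + (- y) * 0"
      by (intro tendsto_intros lim)
    moreover have "y ^ N * D (N + Suc k) + (- y) * (y ^ N * D (N + k)) = E k" for N
      using E_pow[of k N] by (simp add: E_def algebra_simps)
    ultimately show ?thesis
      by (simp add: LIMSEQ_const_iff)
  qed
  then have D: "D (Suc k) = y * D k" for k
    by (simp add: E_def)
  have "(1 - y\<^sup>2) * D 0 = 0"
    using rec0 D[of 0] by (simp add: algebra_simps power2_eq_square)
  then have "D 0 = 0" using y by auto
  then show ?thesis
    by (induction k) (auto simp: D)
qed

text \<open>Since \<open>s * s = 1\<close>, (1 - s y)^2 = 1 - 2 s y + y^2; multiplying by it absorbs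
  the term with \<open>2 * s\<close> and yields the shape of the recurrence for
  correlations.\<close>

lemma recurrence_clear_denominator:
  fixes a y s :: "'a::comm_ring_1"
  assumes s: "s * s = 1" and ay: "a * (1 - s * y)\<^sup>2 = y"
    and rec: "A = G + a * (S - 2 * s * A)"
  shows "(1 + y\<^sup>2) * A = y * S + (1 - s * y)\<^sup>2 * G"
proof -
  have ss: "s * (s * x) = x" for x
    by (simp add: s flip: mult.assoc)
  have sq: "(1 - s * y)\<^sup>2 = 1 + y\<^sup>2 - 2 * s * y"
    by (simp add: power2_eq_square algebra_simps ss)
  have "(1 - s * y)\<^sup>2 * A = (1 - s * y)\<^sup>2 * G + a * (1 - s * y)\<^sup>2 * (S - 2 * s * A)"
    by (subst rec) (simp only: distrib_left mult_ac)
  then have "(1 - s * y)\<^sup>2 * A = (1 - s * y)\<^sup>2 * G + y * (S - 2 * s * A)"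
    unfolding ay .
  moreover have "(1 + y\<^sup>2) * A = (1 - s * y)\<^sup>2 * A + 2 * s * y * A"
    unfolding sq by (simp add: algebra_simps)
  ultimately show ?thesis
    by (simp only: right_diff_distrib mult_ac) simp
qed

text \<open>Common core of the formal and the complex case. The hypotheses range over all
  \<open>l \<le> m\<close> because the induction adds one parameter at a time.\<close>

lemma cbin_series_eq_correlation:
  fixes a y :: "nat \<Rightarrow> 'a::{idom,t2_space,topological_ab_group_add,topological_semigroup_mult}"
  assumes s: "s * s = 1"
    and ay: "\<And>n. n \<in> {1..m} \<Longrightarrow> a n * (1 - s * y n)\<^sup>2 = y n"
    and y: "\<And>n. n \<in> {1..m} \<Longrightarrow> (y n)\<^sup>2 \<noteq> 1"
    and A: "\<And>l k. l \<le> m \<Longrightarrow> (\<lambda>i. cbin s k i * hsym a l (k + i)) sums A l k"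
    and C: "\<And>l k. l \<le> m \<Longrightarrow> (\<lambda>j. hsym y l j * hsym y l (j + k)) sums C l k"
    and limA: "\<And>l n k. l \<le> m \<Longrightarrow> n \<in> {1..m} \<Longrightarrow> (\<lambda>N. y n ^ N * A l (N + k)) \<longlonglongrightarrow> 0"
    and limC: "\<And>l n k. l \<le> m \<Longrightarrow> n \<in> {1..m} \<Longrightarrow> (\<lambda>N. y n ^ N * C l (N + k)) \<longlonglongrightarrow> 0"
  shows "A m k = (\<Prod>n=1..m. (1 - s * y n)\<^sup>2) * C m k"
proof -
  have "A l k = (\<Prod>n=1..l. (1 - s * y n)\<^sup>2) * C l k" if "l \<le> m" for l k
    using that
  proof (induction l arbitrary: k)
    case 0
    have "(\<lambda>i. cbin s k i * hsym a 0 (k + i)) = (\<lambda>i. if i = 0 then (if k = 0 then 1 else 0) else 0)"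
         "(\<lambda>j. hsym y 0 j * hsym y 0 (j + k)) = (\<lambda>i. if i = 0 then (if k = 0 then 1 else 0) else 0)"
      by (auto simp: fun_eq_iff hsym_0_left cbin_0)
    then have "A 0 k = C 0 k"
      using A[of 0 k] C[of 0 k] sums_unique2 by fastforce
    then show ?case by simp
  next
    case (Suc l)
    let ?n = "Suc l"
    define P where "P = (\<Prod>n=1..l. (1 - s * y n)\<^sup>2)"
    define B where "B k = P * (1 - s * y ?n)\<^sup>2 * C ?n k" for k
    have n: "?n \<in> {1..m}" using Suc.prems by simp
    have IH: "A l k = P * C l k" for k
      using Suc by (simp add: P_def)
    have sA: "\<And>k. (\<lambda>i. cbin s k i * hsym a ?n (k + i)) sums A ?n k"
         and sG: "\<And>k. (\<lambda>i. cbin s k i * hsym a l (k + i)) sums A l k"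
         and sC: "\<And>k. (\<lambda>j. hsym y ?n j * hsym y ?n (j + k)) sums C ?n k"
         and sD: "\<And>k. (\<lambda>j. hsym y l j * hsym y l (j + k)) sums C l k"
      using A C Suc.prems by simp_all
    have recA: "(1 + (y ?n)\<^sup>2) * A ?n (Suc k)
        = y ?n * (A ?n k + A ?n (Suc (Suc k))) + (1 - s * y ?n)\<^sup>2 * A l (Suc k)" for k
      using recurrence_clear_denominator[OF s ay[OF n], of _ _ "A ?n k + A ?n (Suc (Suc k))"]
        cbin_series_recurrence(1)[OF s sA sG, of k] by (simp add: algebra_simps)
    have recA0: "(1 + (y ?n)\<^sup>2) * A ?n 0
        = 2 * y ?n * A ?n 1 + (1 - s * y ?n)\<^sup>2 * A l 0"
      using recurrence_clear_denominator[OF s ay[OF n], of _ _ "2 * A ?n 1"]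
        cbin_series_recurrence(2)[OF s sA sG] by (simp only: mult_ac)
    \<comment> \<open>By the induction hypothesis \<open>A ?n\<close> and \<open>B\<close> satisfy
      the same inhomogeneous recurrence, so their difference satisfies the homogeneous one.\<close>
    have "A ?n k - B k = 0" for k
    proof (rule recurrence_unique[where y = "y ?n"])
      show "(1 + (y ?n)\<^sup>2) * (A ?n (Suc k) - B (Suc k))
          = y ?n * (A ?n k - B k + (A ?n (Suc (Suc k)) - B (Suc (Suc k))))" for k
        using recA[of k] unfolding B_def IH hsym_correlation_recurrence(1)[OF sC sD, of k]
        by (simp add: algebra_simps)
      show "(1 + (y ?n)\<^sup>2) * (A ?n 0 - B 0) = 2 * y ?n * (A ?n 1 - B 1)"
        using recA0 unfolding B_def IH hsym_correlation_recurrence(2)[OF sC sD]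
        by (simp add: algebra_simps)
      show "(\<lambda>N. y ?n ^ N * (A ?n (N + k) - B (N + k))) \<longlonglongrightarrow> 0" for k
      proof -
        have "(\<lambda>N. y ?n ^ N * A ?n (N + k)
                 + (- (P * (1 - s * y ?n)\<^sup>2)) * (y ?n ^ N * C ?n (N + k)))
               \<longlonglongrightarrow> 0 + (- (P * (1 - s * y ?n)\<^sup>2)) * 0"
          by (intro tendsto_intros limA limC Suc.prems n)
        then show ?thesis
          by (simp add: B_def algebra_simps)
      qed
    qed (rule y[OF n])
    then show ?case
      by (simp add: B_def P_def)
  qed
  then show ?thesis by simp
qed

subsection \<open>Formal power series\<close>

instance fps :: (ab_group_add) topological_ab_group_add
proof
  fix a b :: "'a fps"
  show "LIM x nhds a \<times>\<^sub>F nhds b. fst x + snd x :> nhds (a + b)"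
  proof (rule tendsto_fpsI)
    fix n
    show "\<forall>\<^sub>F x in nhds a \<times>\<^sub>F nhds b. fps_nth (fst x + snd x) n = fps_nth (a + b) n"
      using eventually_prodI[OF eventually_fps_nth_eq_nhds_fps[of n a]
                                eventually_fps_nth_eq_nhds_fps[of n b]]
      by eventually_elim simp
  qed
  show "(uminus \<longlongrightarrow> - a) (nhds a)"
  proof (rule tendsto_fpsI)
    fix n
    show "\<forall>\<^sub>F x in nhds a. fps_nth (- x) n = fps_nth (- a) n"
      using eventually_fps_nth_eq_nhds_fps[of n a] by eventually_elim simp
  qed
qed

text \<open>Coefficient \<open>n\<close> of a product depends on all coefficients up to
  \<open>n\<close> of both factors, hence the strong form of the neighbourhood lemma.\<close>

instance fps :: (ring) topological_semigroup_mult
proof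
  fix a b :: "'a fps"
  show "LIM x nhds a \<times>\<^sub>F nhds b. fst x * snd x :> nhds (a * b)"
  proof (rule tendsto_fpsI)
    fix n
    show "\<forall>\<^sub>F x in nhds a \<times>\<^sub>F nhds b. fps_nth (fst x * snd x) n = fps_nth (a * b) n"
      using eventually_prodI[OF eventually_fps_nth_eq_nhds_fps_strong[of n a]
                                eventually_fps_nth_eq_nhds_fps_strong[of n b]]
      by eventually_elim (auto simp: fps_mult_nth intro!: sum.cong)
  qed
qed

lemma fps_X_power_dvd_nth:
  fixes f :: "'a::comm_ring_1 fps"
  assumes "fps_X ^ j dvd f" "n < j"
  shows "fps_nth f n = 0"
  using assms by (auto simp: fps_X_power_mult_nth elim!: dvdE)

lemma tendsto_fps_X_power_dvd:
  fixes f :: "nat \<Rightarrow> 'a::comm_ring_1 fps"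
  assumes "\<And>j. fps_X ^ j dvd f j"
  shows "f \<longlonglongrightarrow> 0"
proof (rule tendsto_fpsI)
  fix n
  show "\<forall>\<^sub>F j in sequentially. fps_nth (f j) n = fps_nth 0 n"
    using eventually_gt_at_top[of n]
    by eventually_elim (simp add: fps_X_power_dvd_nth[OF assms])
qed

text \<open>Coefficient \<open>n\<close> receives contributions only from terms with
  \<open>j \<le> n\<close>, so the partial sums stabilise in each coefficient.\<close>

lemma summable_fps_X_power_dvd:
  fixes f :: "nat \<Rightarrow> 'a::comm_ring_1 fps"
  assumes "\<And>j. fps_X ^ j dvd f j"
  shows "summable f"
proof -
  have "f sums Abs_fps (\<lambda>n. \<Sum>j\<le>n. fps_nth (f j) n)"
    unfolding sums_def
  proof (rule tendsto_fpsI)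
    fix n
    show "\<forall>\<^sub>F N in sequentially. fps_nth (\<Sum>i<N. f i) n
        = fps_nth (Abs_fps (\<lambda>n. \<Sum>j\<le>n. fps_nth (f j) n)) n"
      using eventually_gt_at_top[of n]
    proof eventually_elim
      case (elim N)
      have "(\<Sum>i<N. fps_nth (f i) n) = (\<Sum>i\<le>n. fps_nth (f i) n)"
        using elim by (intro sum.mono_neutral_right) (auto simp: fps_X_power_dvd_nth[OF assms])
      then show ?case by (simp add: fps_sum_nth)
    qed
  qed
  then show ?thesis by (rule sums_summable)
qed

text \<open>Each monomial of degree \<open>j\<close> has \<open>j\<close> factors divisible by
  \<open>d\<close>. With \<open>d = fps_X\<close> this is the source of X-adic convergence.\<close>

lemma hsym_power_dvd:
  assumes "\<And>n. n \<in> {1..m} \<Longrightarrow> d dvd x n"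
  shows "d ^ j dvd hsym x m j"
  using assms
proof (induction x m j rule: hsym.induct)
  case (3 x m j)
  then have "d ^ Suc j dvd hsym x m (Suc j)" "d * d ^ j dvd x (Suc m) * hsym x (Suc m) j"
    by (simp, intro mult_dvd_mono) auto
  then show ?case by (simp del: dvd_add_right_iff dvd_add_left_iff)
qed simp_all

text \<open>X-adically, divisibility by powers of \<open>fps_X\<close> supplies every convergence
  condition of the core identity.\<close>

lemma fps_cbin_series:
  fixes a y :: "nat \<Rightarrow> 'a::idom fps"
  assumes s: "s * s = 1"
    and ay: "\<And>n. n \<in> {1..m} \<Longrightarrow> a n * (1 - s * y n)\<^sup>2 = y n"
    and a: "\<And>n. n \<in> {1..m} \<Longrightarrow> fps_X dvd a n"
    and y: "\<And>n. n \<in> {1..m} \<Longrightarrow> fps_X dvd y n"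
  shows "(\<lambda>i. cbin s k i * hsym a m (k + i)) sums
           ((\<Prod>n=1..m. (1 - s * y n)\<^sup>2) * (\<Sum>j. hsym y m j * hsym y m (j + k)))"
proof -
  define A where "A l k = (\<Sum>i. cbin s k i * hsym a l (k + i))" for l k
  define C where "C l k = (\<Sum>j. hsym y l j * hsym y l (j + k))" for l k
  have A: "(\<lambda>i. cbin s k i * hsym a l (k + i)) sums A l k" if "l \<le> m" for l k
    unfolding A_def
  proof (intro summable_sums summable_fps_X_power_dvd dvd_mult)
    fix i
    have "fps_X ^ i dvd (fps_X ^ (k + i) :: 'a fps)"
      by (simp add: le_imp_power_dvd)
    also have "\<dots> dvd hsym a l (k + i)"
      using that by (intro hsym_power_dvd a) auto
    finally show "fps_X ^ i dvd hsym a l (k + i)" .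
  qed
  have C: "(\<lambda>j. hsym y l j * hsym y l (j + k)) sums C l k" if "l \<le> m" for l k
    unfolding C_def using that
    by (intro summable_sums summable_fps_X_power_dvd dvd_mult2 hsym_power_dvd y) auto
  have "A m k = (\<Prod>n=1..m. (1 - s * y n)\<^sup>2) * C m k"
  proof (rule cbin_series_eq_correlation[OF s ay _ A C])
    fix n assume n: "n \<in> {1..m}"
    have "fps_X ^ 1 dvd (y n)\<^sup>2"
      using y[OF n] by (simp add: power2_eq_square)
    then have "fps_nth ((y n)\<^sup>2) 0 = 0"
      by (rule fps_X_power_dvd_nth) simp
    then show "(y n)\<^sup>2 \<noteq> 1"
      by (metis fps_one_nth zero_neq_one)
    fix l k
    show "(\<lambda>N. y n ^ N * A l (N + k)) \<longlonglongrightarrow> 0" "(\<lambda>N. y n ^ N * C l (N + k)) \<longlonglongrightarrow> 0"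
      by (intro tendsto_fps_X_power_dvd dvd_mult2 dvd_power_same y n)+
  qed
  with A[of m k] show ?thesis by (simp add: C_def)
qed

subsection \<open>Geometric parameters and Gaussian polynomials\<close>

text \<open>By homogeneity the factor \<open>q\<close> of the parameters contributes q^j q^(j+k) =
  q^k (q^2)^j; this is where \<open>q ^ k\<close> and the argument \<open>q\<^sup>2\<close> of
  \<open>H\<close> come from.\<close>

lemma H_eq_correlation:
  fixes p q :: "'a::{idom_divide,inverse,t2_space,topological_semigroup_mult}"
  assumes m: "m > 0" and p: "\<And>n. qpoch p p n \<noteq> 0"
    and summable: "summable (\<lambda>j. hsym (\<lambda>n. p ^ (n - 1)) m j * hsym (\<lambda>n. p ^ (n - 1)) m (j + k) * (q\<^sup>2) ^ j)"
  shows "q ^ k * H k m p (q\<^sup>2)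
       = (\<Sum>j. hsym (\<lambda>n. q * p ^ (n - 1)) m j * hsym (\<lambda>n. q * p ^ (n - 1)) m (j + k))"
proof -
  let ?g = "hsym (\<lambda>n. p ^ (n - 1)) m"
  have H: "H k m p (q\<^sup>2) = (\<Sum>j. ?g j * ?g (j + k) * (q\<^sup>2) ^ j)"
    unfolding H_def
  proof (rule suminf_cong)
    fix j
    have "int m - 1 + int k + int j = int m - 1 + int (j + k)" "int k + int j = int (j + k)"
      by simp_all
    then show "gauss_binom p (int m - 1 + int j) (int j) *
          gauss_binom p (int m - 1 + int k + int j) (int k + int j) * (q\<^sup>2) ^ j
        = ?g j * ?g (j + k) * (q\<^sup>2) ^ j"
      by (simp only: gauss_binom_eq_hsym[OF m p])
  qed
  have "(\<lambda>j. q ^ k * (?g j * ?g (j + k) * (q\<^sup>2) ^ j)) sums (q ^ k * H k m p (q\<^sup>2))"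
    unfolding H by (intro sums_cmult summable_sums summable)
  also have "(\<lambda>j. q ^ k * (?g j * ?g (j + k) * (q\<^sup>2) ^ j))
      = (\<lambda>j. hsym (\<lambda>n. q * p ^ (n - 1)) m j * hsym (\<lambda>n. q * p ^ (n - 1)) m (j + k))"
    by (simp only: hsym_scale fun_eq_iff) (simp add: power_add power_mult_distrib power2_eq_square mult_ac)
  finally show ?thesis by (rule sums_unique)
qed

lemma qpoch_square: "(qpoch (s * q) p m)\<^sup>2 = (\<Prod>n=1..m. (1 - s * (q * p ^ (n - 1)))\<^sup>2)"
  by (simp add: qpoch_def prod_power_distrib prod.atLeast1_atMost_eq mult.assoc)

text \<open>Both parameter families take the form \<open>q * p ^ (n - 1)\<close>, with
  \<open>p = q\<close> for \<open>V\<close> and \<open>p = q\<^sup>2\<close> for \<open>W\<close>.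
  The condition \<open>n \<ge> 1\<close> guards the truncated subtractions.\<close>

lemma power_eq_mult_power:
  fixes q :: "'a::comm_monoid_mult"
  shows "n \<ge> 1 \<Longrightarrow> q ^ n = q * q ^ (n - 1)"
    and "n \<ge> 1 \<Longrightarrow> q ^ (2 * n - 1) = q * (q\<^sup>2) ^ (n - 1)"
  by (cases n; simp add: power_mult)+

lemma V_term_eq:
  "V_term s k m q = (\<lambda>i. cbin (of_int s) k i
     * hsym (\<lambda>n. q * q ^ (n - 1) / (1 - of_int s * (q * q ^ (n - 1)))\<^sup>2) m (k + i))"
proof -
  have "V s j m q
      = hsym (\<lambda>n. q * q ^ (n - 1) / (1 - of_int s * (q * q ^ (n - 1)))\<^sup>2) m j" for j
  proof -
    have "V s j m q = hsym (\<lambda>n. q ^ n / (1 - of_int s * q ^ n)\<^sup>2) m j"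
      unfolding V_def by (rule sum_chains_eq_hsym)
    also have "\<dots> = hsym (\<lambda>n. q * q ^ (n - 1) / (1 - of_int s * (q * q ^ (n - 1)))\<^sup>2) m j"
    proof (rule hsym_cong)
      fix n assume "n \<in> {1..m}"
      then have e: "q ^ n = q * q ^ (n - 1)"
        by (intro power_eq_mult_power) simp
      show "q ^ n / (1 - of_int s * q ^ n)\<^sup>2
          = q * q ^ (n - 1) / (1 - of_int s * (q * q ^ (n - 1)))\<^sup>2"
        by (simp only: e)
    qed
    finally show ?thesis .
  qed
  then show ?thesis
    unfolding V_term_def cbin_def by simp
qed

lemma W_term_eq:
  "W_term s k m q = (\<lambda>i. cbin (of_int s) k i
     * hsym (\<lambda>n. q * (q\<^sup>2) ^ (n - 1) / (1 - of_int s * (q * (q\<^sup>2) ^ (n - 1)))\<^sup>2) m (k + i))"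
proof -
  have "W s j m q
      = hsym (\<lambda>n. q * (q\<^sup>2) ^ (n - 1) / (1 - of_int s * (q * (q\<^sup>2) ^ (n - 1)))\<^sup>2) m j" for j
  proof -
    have "W s j m q = hsym (\<lambda>n. q ^ (2 * n - 1) / (1 - of_int s * q ^ (2 * n - 1))\<^sup>2) m j"
      unfolding W_def by (rule sum_chains_eq_hsym)
    also have "\<dots> = hsym (\<lambda>n. q * (q\<^sup>2) ^ (n - 1) / (1 - of_int s * (q * (q\<^sup>2) ^ (n - 1)))\<^sup>2) m j"
    proof (rule hsym_cong)
      fix n assume "n \<in> {1..m}"
      then have e: "q ^ (2 * n - 1) = q * (q\<^sup>2) ^ (n - 1)"
        by (intro power_eq_mult_power) simp
      show "q ^ (2 * n - 1) / (1 - of_int s * q ^ (2 * n - 1))\<^sup>2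
          = q * (q\<^sup>2) ^ (n - 1) / (1 - of_int s * (q * (q\<^sup>2) ^ (n - 1)))\<^sup>2"
        by (simp only: e)
    qed
    finally show ?thesis .
  qed
  then show ?thesis
    unfolding W_term_def cbin_def by simp
qed

lemma fps_geometric_hsym_sums:
  fixes p :: "'a::field fps" and s :: int
  assumes m: "m > 0" and s: "s = 1 \<or> s = -1" and p: "fps_X dvd p"
  shows "(\<lambda>i. cbin (of_int s) k i
     * hsym (\<lambda>n. fps_X * p ^ (n - 1) / (1 - of_int s * (fps_X * p ^ (n - 1)))\<^sup>2) m (k + i))
     sums ((qpoch (of_int s * fps_X) p m)\<^sup>2 * fps_X ^ k * H k m p (fps_X\<^sup>2))"
proof -
  let ?y = "\<lambda>n::nat. fps_X * p ^ (n - 1)"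
  let ?a = "\<lambda>n. ?y n / (1 - of_int s * ?y n)\<^sup>2"
  \<comment> \<open>\<open>fps_X\<close> divides \<open>?y n\<close>, so the square has constant
    term 1 and is a unit: the quotient \<open>?a n\<close> is a genuine one.\<close>
  have unit: "(1 - of_int s * ?y n)\<^sup>2 dvd 1" for n
    by (simp add: power2_eq_square)
  have a: "?a n * (1 - of_int s * ?y n)\<^sup>2 = ?y n" for n
    using unit[of n] by (simp add: unit_div_mult_self)
  have "fps_X dvd ?a n * (1 - of_int s * ?y n)\<^sup>2" for n
    unfolding a by simp
  then have dvd: "fps_X dvd ?a n" for n
    using unit[of n] dvd_mult_unit_iff by blast
  have "fps_nth p 0 = 0"
    using fps_X_power_dvd_nth[of 1 p 0] p by simp
  then have "fps_nth (qpoch p p n) 0 = 1" for n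
    by (induction n) (simp_all add: qpoch_def)
  then have nz: "qpoch p p n \<noteq> 0" for n
    by (metis fps_zero_nth zero_neq_one)
  have "(\<lambda>i. cbin (of_int s) k i * hsym ?a m (k + i)) sums
      ((\<Prod>n=1..m. (1 - of_int s * ?y n)\<^sup>2) * (\<Sum>j. hsym ?y m j * hsym ?y m (j + k)))"
    by (rule fps_cbin_series) (use s a dvd in auto)
  also have "(\<Sum>j. hsym ?y m j * hsym ?y m (j + k)) = fps_X ^ k * H k m p (fps_X\<^sup>2)"
    by (rule H_eq_correlation[symmetric, OF m nz])
       (intro summable_fps_X_power_dvd dvd_mult dvd_power_same, simp add: power2_eq_square)
  finally show ?thesis
    by (simp only: qpoch_square mult.assoc)
qed

subsection \<open>Absolutely convergent complex series\<close>

lemma hsym_nonneg: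
  fixes x :: "nat \<Rightarrow> real"
  assumes "\<And>n. n \<in> {1..m} \<Longrightarrow> 0 \<le> x n"
  shows "0 \<le> hsym x m j"
  using assms by (induction x m j rule: hsym.induct) auto

lemma hsym_mono:
  fixes x z :: "nat \<Rightarrow> real"
  assumes "\<And>n. n \<in> {1..m} \<Longrightarrow> 0 \<le> x n \<and> x n \<le> z n"
  shows "hsym x m j \<le> hsym z m j"
  using assms
proof (induction x m j rule: hsym.induct)
  case (3 x m j)
  have "x (Suc m) * hsym x (Suc m) j \<le> z (Suc m) * hsym z (Suc m) j"
    using 3 by (intro mult_mono hsym_nonneg) (auto intro: order_trans)
  with 3 show ?case by (auto intro!: add_mono)
qed auto

lemma norm_hsym_le:
  fixes x :: "nat \<Rightarrow> 'a::real_normed_field"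
  shows "norm (hsym x m j) \<le> hsym (\<lambda>n. norm (x n)) m j"
proof (induction x m j rule: hsym.induct)
  case (3 x m j)
  have "norm (hsym x (Suc m) (Suc j))
      \<le> norm (hsym x m (Suc j)) + norm (x (Suc m)) * norm (hsym x (Suc m) j)"
    by (simp add: norm_triangle_le norm_mult)
  also have "\<dots> \<le> hsym (\<lambda>n. norm (x n)) (Suc m) (Suc j)"
    using 3 by (auto intro!: add_mono mult_left_mono)
  finally show ?case .
qed auto

lemma summable_hsym:
  fixes x :: "nat \<Rightarrow> real"
  assumes "\<And>n. n \<in> {1..m} \<Longrightarrow> 0 \<le> x n \<and> x n < 1"
  shows "summable (hsym x m)"
  using assms
proof (induction m)
  case 0
  show ?case
    by (rule summable_finite[of "{0}"]) (auto simp: hsym_0_left)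
next
  case (Suc m)
  let ?z = "x (Suc m)"
  define G where "G = suminf (hsym x m)"
  have z: "0 \<le> ?z" "?z < 1" using Suc.prems[of "Suc m"] by auto
  have sG: "summable (hsym x m)" using Suc by simp
  have part: "(\<Sum>j\<le>N. hsym x m j) \<le> G" for N
    unfolding G_def by (intro sum_le_suminf sG) (use Suc.prems in \<open>auto intro!: hsym_nonneg\<close>)
  have step: "(\<Sum>j\<le>Suc N. hsym x (Suc m) j)
      = (\<Sum>j\<le>Suc N. hsym x m j) + ?z * (\<Sum>j\<le>N. hsym x (Suc m) j)" for N
    by (simp only: sum.atMost_Suc_shift hsym.simps sum.distrib sum_distrib_left add.assoc)
  \<comment> \<open>\<open>G / (1 - ?z)\<close> is the fixed point of x -> G + ?z x, so the bound
    survives the passage from \<open>N\<close> to \<open>Suc N\<close>.\<close>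
  have "(\<Sum>j\<le>N. hsym x (Suc m) j) \<le> G / (1 - ?z)" for N
  proof (induction N)
    case 0
    have "(1::real) \<le> G" using part[of 0] by simp
    also have "G \<le> G / (1 - ?z)"
      using z \<open>1 \<le> G\<close> by (simp add: field_simps)
    finally show ?case by simp
  next
    case (Suc N)
    have "(\<Sum>j\<le>Suc N. hsym x (Suc m) j) \<le> G + ?z * (G / (1 - ?z))"
      unfolding step by (intro add_mono part mult_left_mono Suc z)
    also have "\<dots> = G / (1 - ?z)" using z by (simp add: field_simps)
    finally show ?case .
  qed
  then show ?case
    by (intro bounded_imp_summable hsym_nonneg) (use Suc.prems in auto)
qed

text \<open>Source of the constant 1/4: the binomial is at most 4^(k+i), and homogeneity moves this
  power into the parameters.\<close>

lemma norm_cbin_hsym_le: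
  fixes a :: "nat \<Rightarrow> complex"
  assumes s: "norm s = 1"
  shows "norm (cbin s k i * hsym a m (k + i)) \<le> hsym (\<lambda>n. 4 * norm (a n)) m (k + i)"
proof -
  have "real ((2 * (k + i)) choose i) \<le> real (2 ^ (2 * (k + i)))"
    by (intro of_nat_mono binomial_le_pow2)
  also have "\<dots> = 4 ^ (k + i)"
    unfolding power_mult by simp
  finally have "norm (cbin s k i) \<le> 4 ^ (k + i)"
    by (simp add: cbin_def norm_mult norm_power s)
  then show ?thesis
    unfolding norm_mult hsym_scale by (intro mult_mono norm_hsym_le) auto
qed

text \<open>Domination by one positive series. The bound is the same for all \<open>k\<close>, on
  which the limit condition for y^N A_(N+k) relies.\<close>

lemma
  fixes a :: "nat \<Rightarrow> complex"
  assumes s: "norm s = 1" and a: "\<And>n. n \<in> {1..m} \<Longrightarrow> norm (a n) < 1 / 4"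
  shows summable_cbin_series: "summable (\<lambda>i. cbin s k i * hsym a m (k + i))"
    and norm_cbin_series_le: "norm (\<Sum>i. cbin s k i * hsym a m (k + i)) \<le> (\<Sum>j. hsym (\<lambda>n. 4 * norm (a n)) m j)"
proof -
  let ?u = "hsym (\<lambda>n. 4 * norm (a n)) m"
  have u: "summable ?u"
    using a by (intro summable_hsym) force
  then have uk: "summable (\<lambda>i. ?u (k + i))"
    by (subst add.commute) (rule summable_ignore_initial_segment)
  then show "summable (\<lambda>i. cbin s k i * hsym a m (k + i))"
    by (rule summable_comparison_test') (rule norm_cbin_hsym_le[OF s])
  have "norm (\<Sum>i. cbin s k i * hsym a m (k + i)) \<le> (\<Sum>i. ?u (k + i))"
    using uk by (intro norm_suminf_le norm_cbin_hsym_le s)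
  also have "\<dots> \<le> suminf ?u"
    using suminf_split_initial_segment[OF u, of k]
    by (simp add: add.commute sum_nonneg hsym_nonneg)
  finally show "norm (\<Sum>i. cbin s k i * hsym a m (k + i)) \<le> suminf ?u" .
qed

lemma summable_hsym_mult_shift:
  fixes x :: "nat \<Rightarrow> real"
  assumes x: "\<And>n. n \<in> {1..m} \<Longrightarrow> 0 \<le> x n \<and> x n < 1"
  shows "summable (\<lambda>j. hsym x m j * hsym x m (j + k))"
    and "(\<Sum>j. hsym x m j * hsym x m (j + k)) \<le> (suminf (hsym x m))\<^sup>2"
proof -
  let ?u = "hsym x m"
  have u: "summable ?u" by (rule summable_hsym[OF x])
  have nn: "0 \<le> ?u j" for j by (intro hsym_nonneg) (use x in auto)
  have le: "?u j \<le> suminf ?u" for j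
    using sum_le_suminf[OF u, of "{j}"] nn by simp
  have bnd: "?u j * ?u (j + k) \<le> ?u j * suminf ?u" for j
    by (intro mult_left_mono le nn)
  have s2: "summable (\<lambda>j. ?u j * suminf ?u)"
    by (intro summable_mult2 u)
  then show 1: "summable (\<lambda>j. ?u j * ?u (j + k))"
    by (rule summable_comparison_test') (use bnd nn in \<open>auto simp: abs_mult\<close>)
  have "(\<Sum>j. ?u j * ?u (j + k)) \<le> (\<Sum>j. ?u j * suminf ?u)"
    by (rule suminf_le[OF bnd 1 s2])
  also have "\<dots> = (suminf ?u)\<^sup>2"
    by (simp add: suminf_mult2[OF u, symmetric] power2_eq_square)
  finally show "(\<Sum>j. ?u j * ?u (j + k)) \<le> (suminf ?u)\<^sup>2" .
qed

lemma norm_hsym_mult_shift_le: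
  fixes y :: "nat \<Rightarrow> complex"
  assumes "\<And>n. n \<in> {1..m} \<Longrightarrow> norm (y n) \<le> x n"
  shows "norm (hsym y m j * hsym y m l) \<le> hsym x m j * hsym x m l"
proof -
  have "norm (hsym y m j) \<le> hsym x m j" for j
    by (rule order_trans[OF norm_hsym_le hsym_mono]) (use assms in auto)
  moreover have "0 \<le> hsym x m j" for j
    by (intro hsym_nonneg) (use assms norm_ge_zero order_trans in blast)
  ultimately show ?thesis
    unfolding norm_mult by (intro mult_mono) auto
qed

lemma
  fixes y :: "nat \<Rightarrow> complex"
  assumes y: "\<And>n. n \<in> {1..m} \<Longrightarrow> norm (y n) < 1"
  shows summable_hsym_correlation: "summable (\<lambda>j. hsym y m j * hsym y m (j + k))"
    and norm_hsym_correlation_le: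
      "norm (\<Sum>j. hsym y m j * hsym y m (j + k)) \<le> (suminf (hsym (\<lambda>n. norm (y n)) m))\<^sup>2"
proof -
  let ?u = "hsym (\<lambda>n. norm (y n)) m"
  have bnd: "norm (hsym y m j * hsym y m (j + k)) \<le> ?u j * ?u (j + k)" for j
    by (rule norm_hsym_mult_shift_le) simp
  have u: "summable (\<lambda>j. ?u j * ?u (j + k))"
    by (rule summable_hsym_mult_shift) (use y in auto)
  then show "summable (\<lambda>j. hsym y m j * hsym y m (j + k))"
    by (rule summable_comparison_test') (rule bnd)
  have "norm (\<Sum>j. hsym y m j * hsym y m (j + k)) \<le> (\<Sum>j. ?u j * ?u (j + k))"
    by (rule norm_suminf_le[OF bnd u])
  also have "\<dots> \<le> (suminf ?u)\<^sup>2"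
    by (rule summable_hsym_mult_shift) (use y in auto)
  finally show "norm (\<Sum>j. hsym y m j * hsym y m (j + k)) \<le> (suminf ?u)\<^sup>2" .
qed

lemma power_times_bounded_tendsto_0:
  fixes y :: complex
  assumes "norm y < 1" and "\<And>k. norm (A k) \<le> B"
  shows "(\<lambda>N. y ^ N * A (N + k)) \<longlonglongrightarrow> 0"
proof (rule Lim_null_comparison)
  show "\<forall>\<^sub>F N in sequentially. norm (y ^ N * A (N + k)) \<le> norm y ^ N * B"
    by (simp add: norm_mult norm_power mult_left_mono assms)
  show "(\<lambda>N. norm y ^ N * B) \<longlonglongrightarrow> 0"
    by (intro tendsto_mult_left_zero LIMSEQ_realpow_zero) (use assms in auto)
qed

lemma complex_cbin_series:
  fixes a y :: "nat \<Rightarrow> complex"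
  assumes s: "s * s = 1"
    and ay: "\<And>n. n \<in> {1..m} \<Longrightarrow> a n * (1 - s * y n)\<^sup>2 = y n"
    and a: "\<And>n. n \<in> {1..m} \<Longrightarrow> norm (a n) < 1 / 4"
    and y: "\<And>n. n \<in> {1..m} \<Longrightarrow> norm (y n) < 1"
  shows "(\<Sum>i. cbin s k i * hsym a m (k + i))
       = (\<Prod>n=1..m. (1 - s * y n)\<^sup>2) * (\<Sum>j. hsym y m j * hsym y m (j + k))"
proof -
  have ns: "norm s = 1"
    using s by (auto simp: square_eq_1_iff)
  show ?thesis
  proof (rule cbin_series_eq_correlation[OF s ay])
    fix l k assume "l \<le> m"
    then show "(\<lambda>i. cbin s k i * hsym a l (k + i)) sums (\<Sum>i. cbin s k i * hsym a l (k + i))"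
      by (intro summable_sums summable_cbin_series ns a) auto
    show "(\<lambda>j. hsym y l j * hsym y l (j + k)) sums (\<Sum>j. hsym y l j * hsym y l (j + k))"
      using \<open>l \<le> m\<close> by (intro summable_sums summable_hsym_correlation y) auto
    fix n assume n: "n \<in> {1..m}"
    show "(\<lambda>N. y n ^ N * (\<Sum>i. cbin s (N + k) i * hsym a l (N + k + i))) \<longlonglongrightarrow> 0"
      by (rule power_times_bounded_tendsto_0[OF y[OF n],
            where A = "\<lambda>k. \<Sum>i. cbin s k i * hsym a l (k + i)"])
         (rule norm_cbin_series_le[OF ns], use a \<open>l \<le> m\<close> in auto)
    show "(\<lambda>N. y n ^ N * (\<Sum>j. hsym y l j * hsym y l (j + (N + k)))) \<longlonglongrightarrow> 0"
      by (rule power_times_bounded_tendsto_0[OF y[OF n],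
            where A = "\<lambda>k. \<Sum>j. hsym y l j * hsym y l (j + k)"])
         (rule norm_hsym_correlation_le, use y \<open>l \<le> m\<close> in auto)
  next
    fix n assume "n \<in> {1..m}"
    then have "norm ((y n)\<^sup>2) < 1"
      using y by (simp add: norm_power power_less_one_iff abs_square_less_1)
    then show "(y n)\<^sup>2 \<noteq> 1" by auto
  qed
qed

subsection \<open>The boundary of the disc of convergence\<close>

text \<open>Summation by parts: the tails satisfy f n = r n - r (n+1), which turns the power series
  into S - (1 - x) R x. As the tails tend to 0, so does (1 - x) R x.\<close>

lemma Abel_limit_at_left_1:
  fixes f :: "nat \<Rightarrow> complex"
  assumes f: "f sums S"
  shows "((\<lambda>x::real. \<Sum>n. f n * of_real x ^ n) \<longlongrightarrow> S) (at_left 1)"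
proof -
  define r where "r n = S - (\<Sum>i<n. f i)" for n
  have "r \<longlonglongrightarrow> S - S"
    unfolding r_def using f by (intro tendsto_intros) (simp add: sums_def)
  then have r0: "r \<longlonglongrightarrow> 0" by simp
  then obtain B where B: "\<And>n. norm (r n) \<le> B" and "B > 0"
    by (metis BseqE convergentI Bseq_eq_bounded convergent_imp_Bseq)
  define R where "R x = (\<Sum>n. r (Suc n) * of_real x ^ n)" for x :: real
  have summ: "summable (\<lambda>n. r (n + k) * of_real x ^ n)" if "0 < x" "x < 1" for x :: real and k
  proof (rule summable_comparison_test')
    show "summable (\<lambda>n. B * x ^ n)"
      using that by (intro summable_mult summable_geometric) auto
    show "norm (r (n + k) * of_real x ^ n) \<le> B * x ^ n" for n
      using that B[of "n + k"] by (simp add: norm_mult norm_power mult_right_mono)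
  qed
  have eq: "(\<Sum>n. f n * of_real x ^ n) = S - of_real (1 - x) * R x" if x: "0 < x" "x < 1" for x :: real
  proof -
    have s0: "summable (\<lambda>n. r n * of_real x ^ n)" and s1: "summable (\<lambda>n. r (Suc n) * of_real x ^ n)"
      using summ[OF x, of 0] summ[OF x, of 1] by simp_all
    have "(\<Sum>n. f n * of_real x ^ n) = (\<Sum>n. r n * of_real x ^ n - r (Suc n) * of_real x ^ n)"
      by (intro suminf_cong) (simp add: r_def algebra_simps)
    also have "\<dots> = (\<Sum>n. r n * of_real x ^ n) - R x"
      unfolding R_def by (rule suminf_diff[symmetric, OF s0 s1])
    also have "(\<Sum>n. r n * of_real x ^ n) = r 0 + (\<Sum>n. r (Suc n) * of_real x ^ Suc n)"
      using suminf_split_head[OF s0] by simp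
    also have "(\<Sum>n. r (Suc n) * of_real x ^ Suc n) = of_real x * R x"
      unfolding R_def suminf_mult[OF s1, symmetric] by (simp add: mult_ac)
    also have "r 0 = S" by (simp add: r_def)
    finally show ?thesis by (simp add: algebra_simps)
  qed
  have "((\<lambda>x. of_real (1 - x) * R x) \<longlongrightarrow> 0) (at_left 1)"
  proof (rule tendstoI)
    fix e :: real assume "e > 0"
    then obtain N where N: "\<And>n. n \<ge> N \<Longrightarrow> norm (r n) < e / 2"
      using LIMSEQ_D[OF r0, of "e / 2"] by auto
    have "((\<lambda>x::real. (1 - x) * (real N * B)) \<longlongrightarrow> (1 - 1) * (real N * B)) (at_left 1)"
      by (intro tendsto_intros)
    then have "\<forall>\<^sub>F x in at_left 1. (1 - x) * (real N * B) < e / 2"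
      using \<open>e > 0\<close> by (intro order_tendstoD(2)) auto
    moreover have "\<forall>\<^sub>F x in at_left 1. x \<in> {0<..<1::real}"
      by (rule eventually_at_left_real) simp
    ultimately show "\<forall>\<^sub>F x in at_left 1. dist (of_real (1 - x) * R x) 0 < e"
    proof eventually_elim
      case (elim x)
      \<comment> \<open>A majorant for the terms of \<open>R x\<close>: \<open>B\<close> covers the
        first \<open>N\<close>, \<open>e / 2 * x ^ n\<close> the rest. Times \<open>1 - x\<close>
        its sum is (1 - x) N B + e/2.\<close>
      let ?g = "\<lambda>n. (if n \<in> {..<N} then B else 0) + e / 2 * x ^ n"
      have "?g sums ((\<Sum>n\<in>{..<N}. B) + e / 2 * (1 / (1 - x)))"
        using elim by (intro sums_add sums_If_finite_set sums_mult geometric_sums) auto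
      then have g: "summable ?g" "suminf ?g = real N * B + e / 2 / (1 - x)"
        by (auto simp: sums_iff)
      have "norm (r (Suc n) * of_real x ^ n) \<le> ?g n" for n
      proof (cases "n < N")
        case True
        have "norm (r (Suc n) * of_real x ^ n) \<le> B * 1"
          unfolding norm_mult using elim B \<open>B > 0\<close>
          by (intro mult_mono) (auto simp: norm_power power_le_one)
        also have "\<dots> \<le> B + e / 2 * x ^ n"
          using elim \<open>e > 0\<close> by simp
        finally show ?thesis using True by simp
      next
        case False
        then have "norm (r (Suc n)) \<le> e / 2" using N[of "Suc n"] by simp
        then show ?thesis
          using False elim by (simp add: norm_mult norm_power mult_right_mono)
      qed
      then have "norm (R x) \<le> real N * B + e / 2 / (1 - x)"
        unfolding R_def g(2)[symmetric] by (rule norm_suminf_le) (rule g(1))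
      then have "(1 - x) * norm (R x) \<le> (1 - x) * (real N * B + e / 2 / (1 - x))"
        using elim by (intro mult_left_mono) auto
      also have "\<dots> = (1 - x) * (real N * B) + e / 2"
        using elim by (simp add: field_simps)
      also have "\<dots> < e" using elim by simp
      finally show ?case
        using elim by (simp only: dist_norm diff_0_right norm_mult norm_of_real) simp
    qed
  qed
  then have "((\<lambda>x. S - of_real (1 - x) * R x) \<longlongrightarrow> S - 0) (at_left 1)"
    by (intro tendsto_intros)
  moreover have "\<forall>\<^sub>F x in at_left 1. S - of_real (1 - x) * R x = (\<Sum>n. f n * of_real x ^ n)"
    using eventually_at_left_real[of 0 "1::real"]
    by (auto elim!: eventually_mono simp: eq)
  ultimately show ?thesis
    by (auto intro: Lim_transform_eventually)
qed

text \<open>The factor \<open>1 - b (Suc m)\<close> telescopes the last parameter away. Convergence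
  therefore excludes \<open>b n = 1\<close> for every \<open>n\<close> in
  \<open>{1..m}\<close>.\<close>

lemma hsym_sums_imp_prod:
  fixes b :: "nat \<Rightarrow> 'a::{comm_ring_1,t2_space,topological_ab_group_add,topological_semigroup_mult}"
  assumes "hsym b m sums S"
  shows "(\<Prod>n=1..m. 1 - b n) * S = 1"
  using assms
proof (induction m arbitrary: S)
  case 0
  have "hsym b 0 = (\<lambda>j. if j = 0 then 1 else 0)"
    by (auto simp: fun_eq_iff hsym_0_left)
  then show ?case
    using 0 sums_single[of 0 "\<lambda>_. 1 :: 'a"] by (simp add: sums_unique2)
next
  case (Suc m)
  have "(\<lambda>j. hsym b (Suc m) j + (- b (Suc m)) * (case j of 0 \<Rightarrow> 0 | Suc i \<Rightarrow> hsym b (Suc m) i))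
      sums (S + (- b (Suc m)) * S)"
    by (intro sums_add sums_cmult sums_case_nat Suc.prems)
  also have "(\<lambda>j. hsym b (Suc m) j + (- b (Suc m)) * (case j of 0 \<Rightarrow> 0 | Suc i \<Rightarrow> hsym b (Suc m) i))
      = hsym b m"
    by (auto simp: fun_eq_iff split: nat.split)
  finally show ?case
    using Suc.IH[of "S + (- b (Suc m)) * S"] by (simp add: algebra_simps)
qed

text \<open>If some \<open>\<bar>a n\<bar> > 1/4\<close>, then \<open>1 / a n\<close> is a pole of the generating function of the \<open>hsym a m\<close>
  inside the disc of radius 4, where that generating function would have to converge.\<close>
lemma summable_cbin_series_imp_le:
  fixes a :: "nat \<Rightarrow> complex"
  assumes s: "norm s = 1"
    and summ: "summable (\<lambda>i. cbin s k i * hsym a m (k + i))"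
    and n: "n \<in> {1..m}"
  shows "norm (a n) \<le> 1 / 4"
proof (rule ccontr)
  assume "\<not> ?thesis"
  then have an: "norm (a n) > 1 / 4" by simp
  define z where "z = 1 / a n"
  have a0: "0 < norm (a n)" using an by linarith
  then have z: "z * a n = 1" by (simp add: z_def)
  have zn: "norm z < 4"
    unfolding z_def norm_divide norm_one pos_divide_less_eq[OF a0] using an by linarith
  obtain B where B: "\<And>i. norm (cbin s k i * hsym a m (k + i)) \<le> B"
    using summable_imp_Bseq[OF summ] unfolding Bseq_def by auto
  \<comment> \<open>Up to a linear factor the bound 4^i is sharp: the binomial is at least the
    central coefficient of \<open>2 * i\<close>. Writing \<open>Suc i\<close> covers
    \<open>i = 0\<close>.\<close>
  have bin: "4 ^ i \<le> 2 * real (Suc i) * norm (cbin s k i)" for i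
  proof -
    have "(4::real) ^ i \<le> 2 * real (Suc i) * real ((2 * i) choose i)"
    proof (cases "i = 0")
      case False
      then have "(4::real) ^ i \<le> 2 * real i * real ((2 * i) choose i)"
        using central_binomial_lower_bound[of i] by (simp add: field_simps)
      also have "\<dots> \<le> 2 * real (Suc i) * real ((2 * i) choose i)"
        by (intro mult_right_mono) auto
      finally show ?thesis .
    qed simp
    also have "\<dots> \<le> 2 * real (Suc i) * real ((2 * (k + i)) choose i)"
      by (intro mult_left_mono of_nat_mono binomial_right_mono) auto
    finally show ?thesis
      by (simp add: cbin_def norm_mult norm_power s)
  qed
  have bound: "norm (z ^ (i + k) * hsym a m (i + k))
      \<le> 2 * B * norm z ^ k * (real (Suc i) * (norm z / 4) ^ i)" for i
  proof -
    have "4 ^ i * norm (hsym a m (k + i)) \<le> 2 * real (Suc i) * norm (cbin s k i) * norm (hsym a m (k + i))"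
      by (intro mult_right_mono bin) simp
    also have "\<dots> = 2 * real (Suc i) * norm (cbin s k i * hsym a m (k + i))"
      by (simp add: norm_mult)
    also have "\<dots> \<le> 2 * real (Suc i) * B"
      by (intro mult_left_mono B) simp
    finally have "norm (hsym a m (k + i)) \<le> 2 * real (Suc i) * B / 4 ^ i"
      by (simp add: field_simps)
    then have "norm z ^ (i + k) * norm (hsym a m (k + i)) \<le> norm z ^ (i + k) * (2 * real (Suc i) * B / 4 ^ i)"
      by (intro mult_left_mono) auto
    also have "\<dots> = 2 * B * norm z ^ k * (real (Suc i) * (norm z / 4) ^ i)"
      by (simp add: power_add power_divide)
    finally show ?thesis
      by (simp add: norm_mult norm_power add.commute)
  qed
  have "summable (\<lambda>i. 2 * B * norm z ^ k * (real (Suc i) * (norm z / 4) ^ i))"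
    by (rule summable_mult, rule sums_summable, rule geometric_deriv_sums) (use zn in simp)
  then have "summable (\<lambda>i. z ^ (i + k) * hsym a m (i + k))"
    by (rule summable_comparison_test') (rule bound)
  then have "summable (hsym (\<lambda>n. z * a n) m)"
    unfolding hsym_scale by (subst (asm) summable_iff_shift)
  then have "(\<Prod>n=1..m. 1 - z * a n) * suminf (hsym (\<lambda>n. z * a n) m) = 1"
    by (intro hsym_sums_imp_prod summable_sums)
  moreover have "(\<Prod>n=1..m. 1 - z * a n) = 0"
    using n z by (intro prod_zero) auto
  ultimately show False by (simp only: mult_zero_left zero_neq_one)
qed

lemma tendsto_hsym:
  fixes g :: "nat \<Rightarrow> complex"
  assumes "\<And>n. n \<in> {1..m} \<Longrightarrow> ((\<lambda>x. f x n) \<longlongrightarrow> g n) F"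
  shows "((\<lambda>x. hsym (f x) m j) \<longlongrightarrow> hsym g m j) F"
  using assms
proof (induction g m j rule: hsym.induct)
  case (3 g m j)
  then show ?case
    by (simp, intro tendsto_intros) auto
qed simp_all

text \<open>Finitely many limits of modulus below 1 leave room for a common \<open>r < 1\<close>
  that eventually bounds all \<open>Y x n\<close>; the constant family \<open>r\<close> gives the
  majorant for Tannery's theorem.\<close>

lemma tendsto_hsym_correlation:
  fixes y :: "nat \<Rightarrow> complex"
  assumes y: "\<And>n. n \<in> {1..m} \<Longrightarrow> norm (y n) < 1"
    and Y: "\<And>n. n \<in> {1..m} \<Longrightarrow> ((\<lambda>x. Y x n) \<longlongrightarrow> y n) F"
    and F: "F \<noteq> bot"
  shows "((\<lambda>x. \<Sum>j. hsym (Y x) m j * hsym (Y x) m (j + k))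
           \<longlongrightarrow> (\<Sum>j. hsym y m j * hsym y m (j + k))) F"
proof -
  define M where "M = Max (insert 0 ((\<lambda>n. norm (y n)) ` {1..m}))"
  have "M < 1" unfolding M_def using y by (subst Max_less_iff) auto
  then obtain r where r: "M < r" "r < 1" using dense by blast
  have le: "norm (y n) \<le> M" if "n \<in> {1..m}" for n
    unfolding M_def by (intro Max_ge) (use that in auto)
  have "0 \<le> M" unfolding M_def by (intro Max_ge) auto
  have "\<forall>\<^sub>F x in F. \<forall>n\<in>{1..m}. norm (Y x n) < r"
  proof (rule eventually_ball_finite, simp, rule ballI)
    fix n assume n: "n \<in> {1..m}"
    show "\<forall>\<^sub>F x in F. norm (Y x n) < r"
      by (rule order_tendstoD(2)[OF tendsto_norm[OF Y[OF n]]]) (use le[OF n] r in simp)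
  qed
  then have bnd: "\<forall>\<^sub>F x in F. \<forall>j. norm (hsym (Y x) m j * hsym (Y x) m (j + k))
      \<le> hsym (\<lambda>_. r) m j * hsym (\<lambda>_. r) m (j + k)"
    by eventually_elim (intro allI norm_hsym_mult_shift_le, force)
  have 1: "\<forall>\<^sub>F (j, x) in at_top \<times>\<^sub>F F. norm (hsym (Y x) m j * hsym (Y x) m (j + k))
      \<le> hsym (\<lambda>_. r) m j * hsym (\<lambda>_. r) m (j + k)"
    using eventually_prodI[OF eventually_True bnd]
    by eventually_elim auto
  have 2: "summable (\<lambda>j. hsym (\<lambda>_. r) m j * hsym (\<lambda>_. r) m (j + k))"
    using r \<open>0 \<le> M\<close> by (intro summable_hsym_mult_shift) auto
  have 3: "((\<lambda>x. hsym (Y x) m j * hsym (Y x) m (j + k))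
      \<longlongrightarrow> hsym y m j * hsym y m (j + k)) F" for j
    by (intro tendsto_intros tendsto_hsym Y)
  show ?thesis
    using tannerys_theorem[OF 3 1 2 F] by blast
qed

section \<open>Inverting the Koebe function by the principal square root\<close>

lemma Re_csqrt_pos:
  assumes "Re w > 0"
  shows "Re (csqrt w) > 0"
  using assms by (simp add: add_nonneg_pos)

text \<open>Points of the right half-plane lie closer to 1 than to -1.\<close>

lemma norm_Cayley_less_1:
  assumes "Re u > 0"
  shows "norm ((u - 1) / (u + 1)) < 1"
proof -
  have "(norm (u - 1))\<^sup>2 < (norm (u + 1))\<^sup>2"
    unfolding cmod_power2 using assms by (simp add: power2_eq_square algebra_simps)
  then have "norm (u - 1) < norm (u + 1)"
    by (rule power2_less_imp_less) simp
  then show ?thesis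
    by (simp add: norm_divide divide_less_eq)
qed

text \<open>With t = s y the equation reads s b = t/(1-t)^2, that is 1 + 4 s b = ((1+t)/(1-t))^2; so
  \<open>u\<close> stands for (1+t)/(1-t).\<close>

lemma Koebe_Cayley:
  fixes u s b :: complex
  assumes s: "s * s = 1" and u: "u\<^sup>2 = 1 + 4 * s * b" "u + 1 \<noteq> 0"
    and y: "y = s * ((u - 1) / (u + 1))"
  shows "b * (1 - s * y)\<^sup>2 = y"
proof -
  have "s * y = (u - 1) / (u + 1)"
    using s unfolding y by (simp flip: mult.assoc)
  then have 1: "1 - s * y = 2 / (u + 1)"
    using u(2) by (simp add: field_simps)
  have "4 * b = s * (s * (4 * b))"
    using s by (simp flip: mult.assoc)
  also have "s * (4 * b) = (u - 1) * (u + 1)"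
    using u(1) by (simp add: algebra_simps power2_eq_square)
  finally have "4 * b = s * ((u - 1) * (u + 1))" .
  then have "b * (1 - s * y)\<^sup>2 = s * ((u - 1) * (u + 1)) / (u + 1)\<^sup>2"
    unfolding 1 by (simp add: power_divide mult.commute)
  also have "\<dots> = y"
    unfolding y using u(2) by (simp add: power2_eq_square)
  finally show ?thesis .
qed

text \<open>The principal root picks the right branch: for |t| < 1 the quotient v = (1+t)/(1-t) has
  positive real part, so v^2 avoids the cut of \<open>csqrt\<close> and
  \<open>csqrt (v\<^sup>2) = v\<close>.\<close>

lemma tendsto_Koebe_inverse:
  fixes s a y :: complex
  assumes s: "s * s = 1" and ay: "a * (1 - s * y)\<^sup>2 = y" and y: "norm y < 1"
    and b: "(b \<longlongrightarrow> a) F"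
  shows "((\<lambda>x. s * ((csqrt (1 + 4 * s * b x) - 1) / (csqrt (1 + 4 * s * b x) + 1))) \<longlongrightarrow> y) F"
proof -
  have ns: "norm s = 1" using s by (auto simp: square_eq_1_iff)
  define t where "t = s * y"
  have t: "norm t < 1" by (simp add: t_def norm_mult ns y)
  then have t1: "1 - t \<noteq> 0" by auto
  define v where "v = (1 + t) / (1 - t)"
  have "1 + 4 * s * a = v\<^sup>2"
  proof -
    have "4 * s * a * (1 - t)\<^sup>2 = 4 * t"
      using arg_cong[OF ay, of "\<lambda>z. 4 * s * z"] by (simp only: t_def mult_ac)
    then have "(1 + 4 * s * a) * (1 - t)\<^sup>2 = (1 - t)\<^sup>2 + 4 * t"
      by (simp only: distrib_right mult_1_left)
    also have "\<dots> = (1 + t)\<^sup>2"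
      by (simp add: algebra_simps power2_eq_square)
    finally have "(1 + 4 * s * a) * (1 - t)\<^sup>2 = (1 + t)\<^sup>2" .
    then show ?thesis
      unfolding v_def power_divide using t1 by (subst eq_divide_eq) simp
  qed
  have vp: "v + 1 = 2 / (1 - t)" and vm: "v - 1 = t * (v + 1)"
    using t1 by (simp_all add: v_def divide_simps)
  have v1: "v + 1 \<noteq> 0"
    unfolding vp using t1 by simp
  have "norm (v - 1) < norm (v + 1)"
    unfolding vm norm_mult using t v1 by simp
  then have "(norm (v - 1))\<^sup>2 < (norm (v + 1))\<^sup>2"
    by (intro power_strict_mono) auto
  then have v: "Re v > 0"
    unfolding cmod_power2 by (simp add: power2_eq_square algebra_simps)
  then have "v\<^sup>2 \<notin> \<real>\<^sub>\<le>\<^sub>0"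
    by (auto simp: complex_nonpos_Reals_iff Re_power2 Im_power2 not_le)
  have "((\<lambda>x. 1 + 4 * s * b x) \<longlongrightarrow> v\<^sup>2) F"
    unfolding \<open>1 + 4 * s * a = v\<^sup>2\<close>[symmetric] by (intro tendsto_intros b)
  then have "((\<lambda>x. csqrt (1 + 4 * s * b x)) \<longlongrightarrow> csqrt (v\<^sup>2)) F"
    by (rule isCont_tendsto_compose[OF continuous_at_csqrt[OF \<open>v\<^sup>2 \<notin> \<real>\<^sub>\<le>\<^sub>0\<close>]])
  also have "csqrt (v\<^sup>2) = v" using v by (intro csqrt_square) auto
  finally have "((\<lambda>x. s * ((csqrt (1 + 4 * s * b x) - 1) / (csqrt (1 + 4 * s * b x) + 1)))
      \<longlongrightarrow> s * ((v - 1) / (v + 1))) F"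
    by (intro tendsto_intros v1)
  also have "(v - 1) / (v + 1) = t"
    using vm v1 by simp
  also have "s * t = y" using s by (simp add: t_def flip: mult.assoc)
  finally show ?thesis .
qed

text \<open>By \<open>summable_cbin_series_imp_le\<close> a convergent series is at worst on the boundary
  \<open>\<bar>a n\<bar> = 1/4\<close>. Replacing \<open>a\<close> by \<open>x a\<close> with \<open>x < 1\<close> gives absolute convergence, and the parameter
  \<open>Y\<close> with \<open>x a = Y / (1 - s Y)\<^sup>2\<close> is found by inverting the Koebe function.\<close>
lemma complex_cbin_series_sums:
  fixes a y :: "nat \<Rightarrow> complex"
  assumes s: "s * s = 1"
    and ay: "\<And>n. n \<in> {1..m} \<Longrightarrow> a n * (1 - s * y n)\<^sup>2 = y n"
    and y: "\<And>n. n \<in> {1..m} \<Longrightarrow> norm (y n) < 1"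
    and summ: "summable (\<lambda>i. cbin s k i * hsym a m (k + i))"
  shows "(\<lambda>i. cbin s k i * hsym a m (k + i)) sums
           ((\<Prod>n=1..m. (1 - s * y n)\<^sup>2) * (\<Sum>j. hsym y m j * hsym y m (j + k)))"
proof -
  have ns: "norm s = 1" using s by (auto simp: square_eq_1_iff)
  define S where "S = (\<Sum>i. cbin s k i * hsym a m (k + i))"
  have S: "(\<lambda>i. cbin s k i * hsym a m (k + i)) sums S"
    unfolding S_def by (rule summable_sums[OF summ])
  define u where "u x n = csqrt (1 + 4 * s * (of_real x * a n))" for x n
  define Y where "Y x n = s * ((u x n - 1) / (u x n + 1))" for x n
  \<comment> \<open>Scaling \<open>a\<close> by \<open>x\<close> multiplies h_(k+i) by x^(k+i): x^i
    produces the power series for Abel's theorem, x^k stays in front.\<close>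
  have eq: "of_real x ^ k * (\<Sum>i. cbin s k i * hsym a m (k + i) * of_real x ^ i)
      = (\<Prod>n=1..m. (1 - s * Y x n)\<^sup>2) * (\<Sum>j. hsym (Y x) m j * hsym (Y x) m (j + k))"
    if x: "0 < x" "x < 1" for x
  proof -
    have xa: "norm (of_real x * a n) < 1 / 4" if n: "n \<in> {1..m}" for n
    proof -
      have "x * norm (a n) \<le> x * (1 / 4)"
        using x summable_cbin_series_imp_le[OF ns summ n] by (intro mult_left_mono) auto
      also have "\<dots> < 1 / 4" using x by simp
      finally show ?thesis using x by (simp add: norm_mult)
    qed
    have u: "Re (u x n) > 0" if "n \<in> {1..m}" for n
    proof -
      have "norm (4 * s * (of_real x * a n)) < 1"
        using xa[OF that] ns by (simp add: norm_mult)
      then have "Re (1 + 4 * s * (of_real x * a n)) > 0"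
        using abs_Re_le_cmod[of "4 * s * (of_real x * a n)"] by auto
      then show ?thesis unfolding u_def by (rule Re_csqrt_pos)
    qed
    have "(\<Sum>i. cbin s k i * hsym (\<lambda>n. of_real x * a n) m (k + i))
        = (\<Prod>n=1..m. (1 - s * Y x n)\<^sup>2) * (\<Sum>j. hsym (Y x) m j * hsym (Y x) m (j + k))"
    proof (rule complex_cbin_series[OF s _ xa])
      fix n assume n: "n \<in> {1..m}"
      show "norm (Y x n) < 1"
        unfolding Y_def norm_mult ns using norm_Cayley_less_1[OF u[OF n]] by simp
      have "u x n + 1 \<noteq> 0"
        using u[OF n] by (auto simp: complex_eq_iff)
      moreover have "(u x n)\<^sup>2 = 1 + 4 * s * (of_real x * a n)"
        by (simp add: u_def)
      ultimately show "of_real x * a n * (1 - s * Y x n)\<^sup>2 = Y x n"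
        using Koebe_Cayley[OF s] Y_def by blast
    qed
    also have "(\<lambda>i. cbin s k i * hsym (\<lambda>n. of_real x * a n) m (k + i))
        = (\<lambda>i. of_real x ^ k * (cbin s k i * hsym a m (k + i) * of_real x ^ i))"
      by (auto simp: hsym_scale power_add)
    also have "suminf \<dots> = of_real x ^ k * (\<Sum>i. cbin s k i * hsym a m (k + i) * of_real x ^ i)"
    proof (rule suminf_mult, rule powser_inside)
      show "summable (\<lambda>i. cbin s k i * hsym a m (k + i) * 1 ^ i)" using summ by simp
    qed (use x in auto)
    finally show ?thesis .
  qed
  have Y: "((\<lambda>x. Y x n) \<longlongrightarrow> y n) (at_left 1)" if n: "n \<in> {1..m}" for n
  proof -
    have "((\<lambda>x. of_real x * a n) \<longlongrightarrow> of_real 1 * a n) (at_left 1)"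
      by (intro tendsto_intros)
    then show ?thesis
      unfolding Y_def u_def by (intro tendsto_Koebe_inverse[OF s ay[OF n] y[OF n]]) simp
  qed
  \<comment> \<open>As \<open>x\<close> tends to 1 from the left, the product side of
    \<open>eq\<close> converges by continuity and the series side by Abel's theorem; the limits
    coincide.\<close>
  have "((\<lambda>x. (\<Prod>n=1..m. (1 - s * Y x n)\<^sup>2) * (\<Sum>j. hsym (Y x) m j * hsym (Y x) m (j + k)))
      \<longlongrightarrow> (\<Prod>n=1..m. (1 - s * y n)\<^sup>2) * (\<Sum>j. hsym y m j * hsym y m (j + k))) (at_left 1)"
    by (intro tendsto_intros tendsto_hsym_correlation y Y) auto
  moreover have "((\<lambda>x. (\<Prod>n=1..m. (1 - s * Y x n)\<^sup>2) * (\<Sum>j. hsym (Y x) m j * hsym (Y x) m (j + k)))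
      \<longlongrightarrow> S) (at_left 1)"
  proof (rule Lim_transform_eventually)
    have "((\<lambda>x. of_real x ^ k * (\<Sum>i. cbin s k i * hsym a m (k + i) * of_real x ^ i))
        \<longlongrightarrow> of_real 1 ^ k * S) (at_left 1)"
      by (intro tendsto_intros Abel_limit_at_left_1 S)
    then show "((\<lambda>x. of_real x ^ k * (\<Sum>i. cbin s k i * hsym a m (k + i) * of_real x ^ i))
        \<longlongrightarrow> S) (at_left 1)" by simp
    show "\<forall>\<^sub>F x in at_left 1. of_real x ^ k * (\<Sum>i. cbin s k i * hsym a m (k + i) * of_real x ^ i)
      = (\<Prod>n=1..m. (1 - s * Y x n)\<^sup>2) * (\<Sum>j. hsym (Y x) m j * hsym (Y x) m (j + k))"
      using eventually_at_left_real[of 0 "1::real"]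
      by (auto elim!: eventually_mono simp: eq)
  qed
  ultimately have "(\<Prod>n=1..m. (1 - s * y n)\<^sup>2) * (\<Sum>j. hsym y m j * hsym y m (j + k)) = S"
    by (intro tendsto_unique[of "at_left (1::real)"]) auto
  with S show ?thesis by simp
qed

lemma complex_geometric_hsym_sums:
  fixes p q :: complex and s :: int
  assumes m: "m > 0" and s: "s = 1 \<or> s = -1" and q: "norm q < 1" and p: "norm p < 1"
    and summ: "summable (\<lambda>i. cbin (of_int s) k i
     * hsym (\<lambda>n. q * p ^ (n - 1) / (1 - of_int s * (q * p ^ (n - 1)))\<^sup>2) m (k + i))"
  shows "(\<lambda>i. cbin (of_int s) k i
     * hsym (\<lambda>n. q * p ^ (n - 1) / (1 - of_int s * (q * p ^ (n - 1)))\<^sup>2) m (k + i))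
     sums ((qpoch (of_int s * q) p m)\<^sup>2 * q ^ k * H k m p (q\<^sup>2))"
proof -
  let ?y = "\<lambda>n::nat. q * p ^ (n - 1)"
  let ?g = "hsym (\<lambda>n. p ^ (n - 1)) m"
  have small: "norm (x * p ^ r) < 1" if "norm x < 1" for x r
  proof -
    have "norm (x * p ^ r) \<le> norm x * 1"
      unfolding norm_mult norm_power using p by (intro mult_left_mono power_le_one) auto
    then show ?thesis using that by simp
  qed
  have nz: "qpoch p p n \<noteq> 0" for n
  proof
    assume "qpoch p p n = 0"
    then obtain r where "p * p ^ r = 1" by (auto simp: qpoch_def)
    then show False using small[OF p, of r] by simp
  qed
  have y: "norm (?y n) < 1" for n by (rule small[OF q])
  have "norm (of_int s * ?y n) < 1" for n
    using y[of n] s by (auto simp: norm_mult)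
  then have "1 - of_int s * ?y n \<noteq> 0" for n
    by (metis norm_one less_irrefl right_minus_eq)
  then have a: "?y n / (1 - of_int s * ?y n)\<^sup>2 * (1 - of_int s * ?y n)\<^sup>2 = ?y n" for n
    by simp
  \<comment> \<open>For \<open>q \<noteq> 0\<close> this is the correlation series divided by
    \<open>q ^ k\<close>; for \<open>q = 0\<close> only the term \<open>j = 0\<close>
    survives.\<close>
  have "summable (\<lambda>j. ?g j * ?g (j + k) * (q\<^sup>2) ^ j)"
  proof (cases "q = 0")
    case False
    have "summable (\<lambda>j. hsym ?y m j * hsym ?y m (j + k))"
      by (rule summable_hsym_correlation) (rule y)
    also have "(\<lambda>j. hsym ?y m j * hsym ?y m (j + k)) = (\<lambda>j. q ^ k * (?g j * ?g (j + k) * (q\<^sup>2) ^ j))"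
      by (simp only: hsym_scale fun_eq_iff) (simp add: power_add power_mult_distrib power2_eq_square mult_ac)
    finally show ?thesis
      using False by (simp only: summable_cmult_iff power_eq_0_iff) simp
  qed simp
  note H = H_eq_correlation[OF m nz this]
  have "(of_int s :: complex) * of_int s = 1" using s by auto
  from complex_cbin_series_sums[OF this a y summ]
  show ?thesis
    by (simp only: qpoch_square mult.assoc H)
qed

text \<open>At complex \<open>q\<close> the left-hand series can diverge, since parameters may
  exceed 1/4 in modulus. Hence the identity is asserted formally and wherever the complex series
  converges, and convergence when all parameters stay below 1/4.\<close>

theorem theorem1:
  fixes k m :: nat and s :: int
  assumes "m > 0" and "s = 1 \<or> s = -1"
  shows
    "V_term s k m (fps_X :: complex fps) sums
       ((qpoch (of_int s * fps_X) fps_X m)\<^sup>2 * fps_X ^ k * H k m fps_X (fps_X\<^sup>2))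
   \<and> W_term s k m (fps_X :: complex fps) sums
       ((qpoch (of_int s * fps_X) (fps_X\<^sup>2) m)\<^sup>2 * fps_X ^ k * H k m (fps_X\<^sup>2) (fps_X\<^sup>2))
   \<and> (\<forall>q::complex. norm q < 1 \<longrightarrow>
        (summable (V_term s k m q) \<longrightarrow>
           V_term s k m q sums ((qpoch (of_int s * q) q m)\<^sup>2 * q ^ k * H k m q (q\<^sup>2)))
      \<and> (summable (W_term s k m q) \<longrightarrow>
           W_term s k m q sums ((qpoch (of_int s * q) (q\<^sup>2) m)\<^sup>2 * q ^ k * H k m (q\<^sup>2) (q\<^sup>2)))
      \<and> ((\<forall>n\<in>{1..m}. norm (q ^ n / (1 - of_int s * q ^ n)\<^sup>2) < 1/4) \<longrightarrow>
           summable (V_term s k m q))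
      \<and> ((\<forall>n\<in>{1..m}. norm (q ^ (2*n-1) / (1 - of_int s * q ^ (2*n-1))\<^sup>2) < 1/4) \<longrightarrow>
           summable (W_term s k m q)))"
proof -
  let ?a = "\<lambda>p q n. q * p ^ (n - 1) / (1 - of_int s * (q * p ^ (n - 1)))\<^sup>2 :: complex"
  have s: "norm (of_int s :: complex) = 1"
    using assms(2) by auto
  have formal:
    "V_term s k m (fps_X :: complex fps) sums
       ((qpoch (of_int s * fps_X) fps_X m)\<^sup>2 * fps_X ^ k * H k m fps_X (fps_X\<^sup>2))"
    "W_term s k m (fps_X :: complex fps) sums
       ((qpoch (of_int s * fps_X) (fps_X\<^sup>2) m)\<^sup>2 * fps_X ^ k * H k m (fps_X\<^sup>2) (fps_X\<^sup>2))"
    unfolding V_term_eq W_term_eq by (rule fps_geometric_hsym_sums[OF assms]; simp add: power2_eq_square)+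
  have complex:
    "V_term s k m q sums ((qpoch (of_int s * q) q m)\<^sup>2 * q ^ k * H k m q (q\<^sup>2))"
    if "norm q < 1" "summable (V_term s k m q)" for q :: complex
    using that unfolding V_term_eq by (intro complex_geometric_hsym_sums[OF assms])
  have complex':
    "W_term s k m q sums ((qpoch (of_int s * q) (q\<^sup>2) m)\<^sup>2 * q ^ k * H k m (q\<^sup>2) (q\<^sup>2))"
    if "norm q < 1" "summable (W_term s k m q)" for q :: complex
    using that unfolding W_term_eq
    by (intro complex_geometric_hsym_sums[OF assms]) (auto simp: norm_power abs_square_less_1)
  have summable_V: "summable (V_term s k m q)"
    if "\<forall>n\<in>{1..m}. norm (q ^ n / (1 - of_int s * q ^ n)\<^sup>2) < 1/4" for q :: complex
    unfolding V_term_eq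
  proof (rule summable_cbin_series[OF s])
    fix n assume n: "n \<in> {1..m}"
    then have e: "q * q ^ (n - 1) = q ^ n"
      by (intro power_eq_mult_power(1)[symmetric]) simp
    show "norm (?a q q n) < 1/4"
      unfolding e using that n by blast
  qed
  have summable_W: "summable (W_term s k m q)"
    if "\<forall>n\<in>{1..m}. norm (q ^ (2*n-1) / (1 - of_int s * q ^ (2*n-1))\<^sup>2) < 1/4" for q :: complex
    unfolding W_term_eq
  proof (rule summable_cbin_series[OF s])
    fix n assume n: "n \<in> {1..m}"
    then have e: "q * (q\<^sup>2) ^ (n - 1) = q ^ (2*n-1)"
      by (intro power_eq_mult_power(2)[symmetric]) simp
    show "norm (?a (q\<^sup>2) q n) < 1/4"
      unfolding e using that n by blast
  qed
  show ?thesis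
    by (intro conjI allI impI formal;
        (rule complex complex', assumption, assumption | rule summable_V summable_W, assumption))
qed

end
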